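(* Let $p=p(k)\ge2$ and suppose $p/k\to\beta\in[0,\infty]$ as $k\to\infty$. Then the number $B_3$ of Braess edges of the broom $\mathcal B_{k,p}$ joining two vertices of its path part satisfies $B_3=\Theta(k\ln k)$.
   Context: For $k\ge3$ and $p\ge2$, the broom $\mathcal B_{k,p}$ is obtained from the path $\mathcal P_k=(1,\dots,k)$ and a star with $p$ leaves by identifying vertex $k$ of the path with the star's center. For a connected graph $G$, $\kappa(G)$ is Kemeny's constant of the simple random walk on $G$: $\kappa(G)=\sum_{j\ne i}m_{ij}\pi_j$ ($m_{ij}$ mean first passage time, $\pi$ stationary distribution); a pair of nonadjacent vertices is a Braess edge if adding the edge between them strictly increases $\kappa$. *)

theory Defs
  imports "HOL-Probability.Probability" "HOL-Library.Landau_Symbols"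
begin

text \<open>
  A simple graph is given by its vertex set and its set of edges, an edge being a set of
  two distinct vertices.
\<close>

definition neighbors :: "'a set \<Rightarrow> 'a set set \<Rightarrow> 'a \<Rightarrow> 'a set" where
  "neighbors V E v = {u \<in> V. {v, u} \<in> E}"

definition rw_step :: "'a set \<Rightarrow> 'a set set \<Rightarrow> 'a \<Rightarrow> 'a pmf" where
  "rw_step V E v = pmf_of_set (neighbors V E v)"

text \<open>The law of the first \<open>n\<close> steps \<open>[X\<^sub>0, \<dots>, X\<^sub>n]\<close> of the simple random walk with \<open>X\<^sub>0 = v\<close>.\<close>

primrec random_walk :: "'a set \<Rightarrow> 'a set set \<Rightarrow> nat \<Rightarrow> 'a \<Rightarrow> 'a list pmf" where
  "random_walk V E 0 v = return_pmf [v]"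
| "random_walk V E (Suc n) v =
     bind_pmf (rw_step V E v) (\<lambda>w. map_pmf (Cons v) (random_walk V E n w))"

text \<open>
  The probability that the walk started at \<open>i\<close> visits \<open>j\<close> for the first time (at a time
  \<open>\<ge> 1\<close>) at time \<open>n\<close>; meaningful for \<open>n \<ge> 1\<close>.
\<close>

definition first_passage_prob :: "'a set \<Rightarrow> 'a set set \<Rightarrow> 'a \<Rightarrow> 'a \<Rightarrow> nat \<Rightarrow> real" where
  "first_passage_prob V E i j n =
     measure_pmf.prob (random_walk V E n i) {xs. xs ! n = j \<and> (\<forall>m\<in>{1..<n}. xs ! m \<noteq> j)}"

text \<open>
  The series converges whenever the graph is finite and connected with at least two vertices.
  The term for \<open>n = 0\<close> vanishes.
\<close>

definition mean_first_passage :: "'a set \<Rightarrow> 'a set set \<Rightarrow> 'a \<Rightarrow> 'a \<Rightarrow> real" where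
  "mean_first_passage V E i j = (\<Sum>n. real n * first_passage_prob V E i j n)"

definition stationary_distribution :: "'a set \<Rightarrow> 'a set set \<Rightarrow> 'a pmf" where
  "stationary_distribution V E =
     (THE \<pi>. set_pmf \<pi> \<subseteq> V \<and> bind_pmf \<pi> (rw_step V E) = \<pi>)"

text \<open>For a connected graph the sum below does not depend on the starting vertex \<open>i\<close>.\<close>

definition kemeny :: "'a set \<Rightarrow> 'a set set \<Rightarrow> real" where
  "kemeny V E =
     (THE K. \<forall>i\<in>V. K = (\<Sum>j\<in>V - {i}.
        mean_first_passage V E i j * pmf (stationary_distribution V E) j))"

definition braess_edges :: "'a set \<Rightarrow> 'a set set \<Rightarrow> 'a set set" where
  "braess_edges V E =
     {{u, v} | u v. u \<in> V \<and> v \<in> V \<and> u \<noteq> v \<and> {u, v} \<notin> E \<and>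
        kemeny V E < kemeny V (insert {u, v} E)}"

text \<open>The path part of the broom is \<open>{1..k}\<close>; the \<open>p\<close> leaves of the star are \<open>k + 1, \<dots>, k + p\<close>.\<close>

definition broom_verts :: "nat \<Rightarrow> nat \<Rightarrow> nat set" where
  "broom_verts k p = {1..k + p}"

definition broom_edges :: "nat \<Rightarrow> nat \<Rightarrow> nat set set" where
  "broom_edges k p = {{i, i + 1} | i. 1 \<le> i \<and> i < k} \<union> {{k, k + l} | l. 1 \<le> l \<and> l \<le> p}"

definition B3 :: "nat \<Rightarrow> nat \<Rightarrow> nat" where
  "B3 k p = card {e \<in> braess_edges (broom_verts k p) (broom_edges k p). e \<subseteq> {1..k}}"

end

theory Submission
  imports Defs "HOL-Real_Asymp.Real_Asymp"
begin

text \<open>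
  Kemeny's constant of a connected graph with degrees \<open>d\<close> and effective resistances \<open>R\<close> is
  \<open>(\<Sum>i j. d i * d j * R i j) / (2 * (\<Sum>i. d i))\<close>, and adding an edge \<open>{a, b}\<close> is a rank-one
  update of \<open>R\<close>.  For a path edge of the broom with \<open>l = b - a\<close> and \<open>c = k + p + 1 - b\<close>, the
  new edge adds a gain that is at most, and near the free end of the path at least, of order
  \<open>k * (k + p)\<close>, against a loss \<open>Q\<close> that lies between constant multiples of \<open>a * c * l\<close> and
  \<open>l * (a + l) * (k + p)\<close>.  Since \<open>a + l + c = k + p + 1\<close>, one of \<open>a, l, c\<close> is at least
  \<open>(k + p) / 3\<close>, so for a Braess edge the product of two of these numbers is at most \<open>45 * k\<close>;
  conversely \<open>a * l \<le> k / 64\<close> and \<open>l\<^sup>2 \<le> k / 64\<close> suffice.  Counting lattice points under a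
  hyperbola gives \<open>k ln k\<close> on both sides, uniformly in \<open>p\<close>.
\<close>

section \<open>Random walks and resistances\<close>

text \<open>Connectedness is stated through sets closed under taking neighbours rather than through
  paths, since the set of maximum points in \<open>maximum_principle\<close> is a set of exactly
  this kind.\<close>

locale connected_graph =
  fixes V :: "'a set" and E :: "'a set set"
  assumes finite_verts: "finite V"
    and verts_nonempty: "V \<noteq> {}"
    and neighbors_nonempty: "i \<in> V \<Longrightarrow> neighbors V E i \<noteq> {}"
    and closed_eq_verts: "U \<subseteq> V \<Longrightarrow> U \<noteq> {} \<Longrightarrow> (\<And>u. u \<in> U \<Longrightarrow> neighbors V E u \<subseteq> U) \<Longrightarrow> U = V"
begin

abbreviation N :: "'a \<Rightarrow> 'a set" where "N \<equiv> neighbors V E"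

abbreviation deg :: "'a \<Rightarrow> real" where "deg i \<equiv> real (card (N i))"

lemma N_subset: "N i \<subseteq> V"
  by (auto simp: neighbors_def)

lemma finite_N [simp]: "finite (N i)"
  using finite_subset[OF N_subset finite_verts] .

lemma in_N_commute: "i \<in> V \<Longrightarrow> u \<in> V \<Longrightarrow> i \<in> N u \<longleftrightarrow> u \<in> N i"
  by (auto simp: neighbors_def insert_commute)

lemma deg_pos: "i \<in> V \<Longrightarrow> deg i > 0"
  using neighbors_nonempty finite_N by (simp add: card_gt_0_iff)

lemma sum_deg_pos: "(\<Sum>i\<in>V. deg i) > 0"
  using finite_verts verts_nonempty deg_pos by (intro sum_pos) auto

section \<open>Maximum principle and harmonic functions\<close>

text \<open>Let \<open>U\<close> be the set where the maximum is attained. If it missed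
  \<open>j\<close>, then at each of its points the maximum would be at most the average over the
  neighbours, so all neighbours would attain it too. Thus \<open>U\<close> would be closed, hence
  all of \<open>V\<close>, a contradiction.\<close>

lemma maximum_principle:
  assumes j: "j \<in> V"
    and sub: "\<And>i. i \<in> V \<Longrightarrow> i \<noteq> j \<Longrightarrow> deg i * y i \<le> (\<Sum>u\<in>N i. y u)"
    and i: "i \<in> V"
  shows "y i \<le> y j"
proof -
  define M where "M = Max (y ` V)"
  have le: "y u \<le> M" if "u \<in> V" for u
    unfolding M_def using that finite_verts by auto
  define U where "U = {u \<in> V. y u = M}"
  have "M \<in> y ` V"
    unfolding M_def using finite_verts verts_nonempty by (intro Max_in) auto
  then have U: "U \<subseteq> V" "U \<noteq> {}"
    by (auto simp: U_def)
  have "j \<in> U"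
  proof (rule ccontr)
    assume nj: "j \<notin> U"
    have "N u \<subseteq> U" if "u \<in> U" for u
    proof -
      from that nj have u: "u \<in> V" "u \<noteq> j" "y u = M" by (auto simp: U_def)
      have nonneg: "\<And>w. w \<in> N u \<Longrightarrow> 0 \<le> M - y w"
        using le N_subset by (auto simp: subset_iff)
      have "(\<Sum>w\<in>N u. M - y w) \<le> 0"
        using sub[OF u(1,2)] u(3) by (simp add: sum_subtractf)
      then have "(\<Sum>w\<in>N u. M - y w) = 0"
        by (intro antisym sum_nonneg nonneg)
      then have "\<forall>w\<in>N u. M - y w = 0"
        using nonneg by (subst (asm) sum_nonneg_eq_0_iff) auto
      then show ?thesis
        using N_subset by (auto simp: U_def)
    qed
    with U have "U = V" by (intro closed_eq_verts) auto
    with j nj show False by simp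
  qed
  then show ?thesis using le[OF i] by (simp add: U_def)
qed

text \<open>The maximum principle for \<open>y\<close> and \<open>- y\<close>. This is the common
  source of uniqueness below: for hitting probabilities, for hitting times, for the stationary
  distribution, and for the independence of Kemeny's constant from the starting vertex.\<close>

lemma harmonic_off_point_const:
  assumes "j \<in> V" and "\<And>i. i \<in> V \<Longrightarrow> i \<noteq> j \<Longrightarrow> deg i * y i = (\<Sum>u\<in>N i. y u)" and "i \<in> V"
  shows "y i = y j"
  using maximum_principle[of j y i] maximum_principle[of j "\<lambda>u. - y u" i] assms
  by (force simp: sum_negf)

section \<open>First passage times\<close>

lemma measure_bind_rw_step:
  assumes "i \<in> V"
  shows "measure (measure_pmf (bind_pmf (rw_step V E i) f)) X = (\<Sum>w\<in>N i. measure (f w) X) / deg i"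
proof -
  have "measure (measure_pmf (bind_pmf (rw_step V E i) f)) X
      = (\<integral>w. measure (measure_pmf (f w)) X \<partial>measure_pmf (rw_step V E i))"
    unfolding measure_pmf_bind
    by (intro measure_pmf.measure_bind[where N = "count_space UNIV"])
       (auto simp: measure_pmf_in_subprob_algebra)
  also have "\<dots> = (\<Sum>w\<in>N i. measure (f w) X) / deg i"
    unfolding rw_step_def
    using neighbors_nonempty[OF assms] by (intro integral_pmf_of_set) auto
  finally show ?thesis .
qed

text \<open>
  Unlike \<open>first_passage_prob\<close>, this counts a visit at time 0, which makes the recursion below
  uniform in \<open>n\<close>.
\<close>

definition hit_prob :: "'a \<Rightarrow> 'a \<Rightarrow> nat \<Rightarrow> real" where
  "hit_prob j i n = (if i = j then of_bool (n = 0) else of_bool (n > 0) * first_passage_prob V E i j n)"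

lemma random_walk_nth_0: "xs \<in> set_pmf (random_walk V E n w) \<Longrightarrow> xs ! 0 = w"
  by (cases n) auto

text \<open>Almost surely \<open>xs ! 0 = i\<close>, which decides the condition at time 0 and
  leaves the one on the times \<open>1..<n\<close>.\<close>

lemma hit_prob_eq:
  "hit_prob j i n = measure_pmf.prob (random_walk V E n i) {xs. xs ! n = j \<and> (\<forall>m<n. xs ! m \<noteq> j)}"
proof -
  have "measure_pmf.prob (random_walk V E n i) {xs. xs ! n = j \<and> (\<forall>m<n. xs ! m \<noteq> j)}
     = measure_pmf.prob (random_walk V E n i)
         (if i = j then (if n = 0 then UNIV else {})
          else if n = 0 then {} else {xs. xs ! n = j \<and> (\<forall>m\<in>{1..<n}. xs ! m \<noteq> j)})"
  proof (intro measure_pmf.finite_measure_eq_AE)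
    have eq: "(xs ! n = j \<and> (\<forall>m<n. xs ! m \<noteq> j)) \<longleftrightarrow>
       (if n = 0 then xs ! 0 = j else xs ! 0 \<noteq> j \<and> xs ! n = j \<and> (\<forall>m\<in>{1..<n}. xs ! m \<noteq> j))" for xs
      by (auto simp: Suc_le_eq)
    show "AE xs in random_walk V E n i. (xs \<in> {xs. xs ! n = j \<and> (\<forall>m<n. xs ! m \<noteq> j)}) =
        (xs \<in> (if i = j then (if n = 0 then UNIV else {})
          else if n = 0 then {} else {xs. xs ! n = j \<and> (\<forall>m\<in>{1..<n}. xs ! m \<noteq> j)}))"
      unfolding AE_measure_pmf_iff mem_Collect_eq eq
      using random_walk_nth_0[of _ n i] by auto
  qed auto
  then show ?thesis
    by (simp add: hit_prob_def first_passage_prob_def)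
qed

lemma hit_prob_nonneg: "hit_prob j i n \<ge> 0"
  by (simp add: hit_prob_eq)

lemma hit_prob_Suc:
  assumes "i \<in> V" "i \<noteq> j"
  shows "hit_prob j i (Suc n) = (\<Sum>w\<in>N i. hit_prob j w n) / deg i"
proof -
  have "(Cons i -` {xs. xs ! Suc n = j \<and> (\<forall>m<Suc n. xs ! m \<noteq> j)}) =
      {xs. xs ! n = j \<and> (\<forall>m<n. xs ! m \<noteq> j)}"
    using assms(2) by (auto simp: nth_Cons split: nat.splits)
  then show ?thesis
    using assms(1) by (simp add: hit_prob_eq measure_bind_rw_step)
qed

lemma mean_first_passage_hit_prob:
  assumes "i \<noteq> j"
  shows "mean_first_passage V E i j = (\<Sum>n. real n * hit_prob j i n)"
  unfolding mean_first_passage_def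
  by (intro suminf_cong) (use assms in \<open>auto simp: hit_prob_def\<close>)

text \<open>Each length \<open>n\<close> has its own law \<open>random_walk V E n i\<close>, so the
  first passages at different times are not disjoint events of one probability space. The first-step
  recursion gives the bound by induction on the horizon instead.\<close>

lemma sum_hit_prob_le_1:
  assumes "i \<in> V"
  shows "(\<Sum>n<m. hit_prob j i n) \<le> 1"
  using assms
proof (induction m arbitrary: i)
  case (Suc m)
  show ?case
  proof (cases "i = j")
    case True
    then show ?thesis by (simp add: hit_prob_def sum.lessThan_Suc_shift)
  next
    case False
    have "(\<Sum>n<Suc m. hit_prob j i n) = (\<Sum>n<m. hit_prob j i (Suc n))"
      using False by (subst sum.lessThan_Suc_shift) (simp add: hit_prob_def)
    also have "\<dots> = (\<Sum>w\<in>N i. \<Sum>n<m. hit_prob j w n) / deg i"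
      using False Suc.prems
      by (simp add: hit_prob_Suc sum_divide_distrib[symmetric] sum.swap[of _ "N i"])
    also have "\<dots> \<le> (\<Sum>w\<in>N i. 1) / deg i"
      using Suc.IH N_subset by (intro divide_right_mono sum_mono) auto
    also have "\<dots> \<le> 1" by simp
    finally show ?thesis .
  qed
qed simp

text \<open>As a function of the starting vertex, the probability of ever hitting \<open>j\<close>
  is harmonic off \<open>j\<close> and equals 1 at \<open>j\<close>, so it is constantly 1.\<close>

lemma hit_prob_sums_1:
  assumes j: "j \<in> V" and i: "i \<in> V"
  shows "hit_prob j i sums 1"
proof -
  define s where "s w = (\<Sum>n. hit_prob j w n)" for w
  have summable: "summable (hit_prob j w)" if "w \<in> V" for w
    using sum_hit_prob_le_1[OF that] by (intro summableI_nonneg_bounded hit_prob_nonneg)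
  have "deg w * s w = (\<Sum>u\<in>N w. s u)" if w: "w \<in> V" "w \<noteq> j" for w
  proof -
    have "s w = (\<Sum>n. hit_prob j w (Suc n))"
      unfolding s_def using suminf_split_head[OF summable[OF w(1)]] w(2) by (simp add: hit_prob_def)
    also have "\<dots> = (\<Sum>n. (\<Sum>u\<in>N w. hit_prob j u n) / deg w)"
      using w by (simp add: hit_prob_Suc)
    also have "\<dots> = (\<Sum>n. \<Sum>u\<in>N w. hit_prob j u n) / deg w"
      using summable N_subset by (intro suminf_divide summable_sum) blast
    also have "(\<Sum>n. \<Sum>u\<in>N w. hit_prob j u n) = (\<Sum>u\<in>N w. s u)"
      unfolding s_def using summable N_subset by (intro suminf_sum) blast
    finally show ?thesis using neighbors_nonempty[OF w(1)] by (simp add: field_simps)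
  qed
  from harmonic_off_point_const[OF j this i] have "s i = s j" .
  also have "s j = (\<Sum>n. if n = 0 then 1 else 0)"
    unfolding s_def by (intro suminf_cong) (simp add: hit_prob_def)
  also have "\<dots> = 1"
    using sums_single[of 0 "\<lambda>_. 1::real"] by (simp add: sums_iff)
  finally show ?thesis
    using summable[OF i] by (simp add: s_def sums_iff)
qed

text \<open>The first-step equations determine the hitting times. The partial sums
  \<open>e m\<close> stay below \<open>M\<close> by induction on \<open>m\<close>, so the series
  converges; its limit \<open>L\<close> satisfies the same equations, and \<open>L - M\<close> is
  harmonic off \<open>j\<close>.\<close>

lemma mean_first_passage_eqI:
  assumes j: "j \<in> V" and "M j = 0"
    and M: "\<And>i. i \<in> V \<Longrightarrow> i \<noteq> j \<Longrightarrow> (\<Sum>u\<in>N i. M i - M u) = deg i"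
    and i: "i \<in> V" "i \<noteq> j"
  shows "mean_first_passage V E i j = M i"
proof -
  have M': "deg w * M w = deg w + (\<Sum>u\<in>N w. M u)" if "w \<in> V" "w \<noteq> j" for w
    using M[OF that] by (simp add: sum_subtractf)
  \<comment> \<open>By \<open>M'\<close>, the function \<open>- M\<close> is subharmonic off
    \<open>j\<close>, so it is largest at \<open>j\<close>, where it vanishes.\<close>
  have M_nonneg: "M w \<ge> 0" if "w \<in> V" for w
    using maximum_principle[of j "\<lambda>w. - M w" w] j that M' \<open>M j = 0\<close> by (simp add: sum_negf)
  define e where "e m w = (\<Sum>n<m. real n * hit_prob j w n)" for m w
  have e_Suc: "e (Suc m) w = (\<Sum>n<m. hit_prob j w (Suc n)) + (\<Sum>u\<in>N w. e m u) / deg w"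
    if w: "w \<in> V" "w \<noteq> j" for m w
  proof -
    have "e (Suc m) w = (\<Sum>n<m. real (Suc n) * hit_prob j w (Suc n))"
      unfolding e_def by (subst sum.lessThan_Suc_shift) simp
    also have "\<dots> = (\<Sum>n<m. hit_prob j w (Suc n)) + (\<Sum>n<m. real n * hit_prob j w (Suc n))"
      by (simp add: algebra_simps sum.distrib)
    also have "(\<Sum>n<m. real n * hit_prob j w (Suc n)) = (\<Sum>u\<in>N w. e m u) / deg w"
      using w by (simp add: hit_prob_Suc e_def sum_divide_distrib[symmetric] sum_distrib_left
          sum.swap[of _ "N w"])
    finally show ?thesis .
  qed
  have e_j: "e m j = 0" for m
    unfolding e_def by (intro sum.neutral) (auto simp: hit_prob_def)
  have e_le: "e m w \<le> M w" if "w \<in> V" for m w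
    using that
  proof (induction m arbitrary: w)
    case 0
    then show ?case using M_nonneg by (simp add: e_def)
  next
    case (Suc m)
    show ?case
    proof (cases "w = j")
      case False
      have "(\<Sum>n<m. hit_prob j w (Suc n)) \<le> 1"
        using sum_hit_prob_le_1[OF Suc.prems, of j "Suc m"] False
        by (subst (asm) sum.lessThan_Suc_shift) (simp add: hit_prob_def)
      moreover have "(\<Sum>u\<in>N w. e m u) / deg w \<le> (\<Sum>u\<in>N w. M u) / deg w"
        using Suc.IH N_subset by (intro divide_right_mono sum_mono) auto
      ultimately have "e (Suc m) w \<le> 1 + (\<Sum>u\<in>N w. M u) / deg w"
        unfolding e_Suc[OF Suc.prems False] by simp
      also have "\<dots> = M w"
        using M'[OF Suc.prems False] neighbors_nonempty[OF Suc.prems] by (simp add: field_simps)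
      finally show ?thesis .
    qed (simp add: e_j \<open>M j = 0\<close>)
  qed
  have summable: "summable (\<lambda>n. real n * hit_prob j w n)" if "w \<in> V" for w
    using e_le[OF that, unfolded e_def]
    by (intro summableI_nonneg_bounded mult_nonneg_nonneg hit_prob_nonneg) auto
  define L where "L w = (\<Sum>n. real n * hit_prob j w n)" for w
  have lim: "(\<lambda>m. e m w) \<longlonglongrightarrow> L w" if "w \<in> V" for w
    unfolding e_def L_def using summable_LIMSEQ[OF summable[OF that]] .
  have "deg w * L w = deg w + (\<Sum>u\<in>N w. L u)" if w: "w \<in> V" "w \<noteq> j" for w
  proof -
    \<comment> \<open>Certain hitting makes the constant term of the limiting recursion exactly
      1.\<close>
    have "(\<lambda>n. hit_prob j w (Suc n)) sums 1"
      using hit_prob_sums_1[OF j w(1)] w(2) sums_Suc_iff[of "hit_prob j w" 1]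
      by (simp add: hit_prob_def)
    then have "(\<lambda>m. (\<Sum>n<m. hit_prob j w (Suc n)) + (\<Sum>u\<in>N w. e m u) / deg w)
        \<longlonglongrightarrow> 1 + (\<Sum>u\<in>N w. L u) / deg w"
      unfolding sums_def using lim N_subset deg_pos[OF w(1)]
      by (intro tendsto_intros) auto
    moreover have "(\<lambda>m. e (Suc m) w) \<longlonglongrightarrow> L w"
      using LIMSEQ_Suc[OF lim[OF w(1)]] .
    ultimately have "L w = 1 + (\<Sum>u\<in>N w. L u) / deg w"
      unfolding e_Suc[OF w] using LIMSEQ_unique by blast
    then show ?thesis using neighbors_nonempty[OF w(1)] by (simp add: field_simps)
  qed
  then have "L i - M i = L j - M j"
    using M' by (intro harmonic_off_point_const[OF j _ i(1)]) (simp add: sum_subtractf algebra_simps)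
  moreover have "L j = 0"
    using lim[OF j] by (simp add: e_j LIMSEQ_const_iff)
  ultimately show ?thesis
    using mean_first_passage_hit_prob[OF i(2)] \<open>M j = 0\<close> by (simp add: L_def)
qed

section \<open>Stationary distribution\<close>

lemma pmf_bind_rw_step:
  assumes sub: "set_pmf P \<subseteq> V" and v: "v \<in> V"
  shows "pmf (bind_pmf P (rw_step V E)) v = (\<Sum>u\<in>N v. pmf P u / deg u)"
proof -
  have "pmf (bind_pmf P (rw_step V E)) v = (\<Sum>u\<in>V. pmf (rw_step V E u) v * pmf P u)"
    unfolding pmf_bind by (rule integral_measure_pmf_real[OF finite_verts]) (use sub in auto)
  also have "\<dots> = (\<Sum>u\<in>V. if u \<in> N v then pmf P u / deg u else 0)"
    using neighbors_nonempty v
    by (intro sum.cong refl) (auto simp: rw_step_def indicator_def in_N_commute)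
  also have "\<dots> = (\<Sum>u\<in>N v. pmf P u / deg u)"
    using N_subset finite_verts by (simp add: sum.If_cases Int_absorb1)
  finally show ?thesis .
qed

text \<open>Because adjacency is symmetric, stationarity of \<open>P\<close> says that
  \<open>pmf P v / deg v\<close> is harmonic at every vertex. It is therefore constant, and
  normalisation fixes the constant.\<close>

lemma stationary_iff:
  assumes sub: "set_pmf P \<subseteq> V"
  shows "bind_pmf P (rw_step V E) = P \<longleftrightarrow> (\<forall>v\<in>V. pmf P v = deg v / (\<Sum>u\<in>V. deg u))"
    (is "?L \<longleftrightarrow> ?R")
proof
  assume ?L
  define r where "r v = pmf P v / deg v" for v
  have eq: "pmf P v = deg v * r v" if "v \<in> V" for v
    using neighbors_nonempty[OF that] by (simp add: r_def)
  have harm: "deg v * r v = (\<Sum>u\<in>N v. r u)" if "v \<in> V" for v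
    using pmf_bind_rw_step[OF sub that] unfolding \<open>?L\<close> r_def[symmetric] eq[OF that] .
  show ?R
  proof
    fix v assume v: "v \<in> V"
    have "r u = r v" if "u \<in> V" for u
      using harm by (intro harmonic_off_point_const[OF v _ that])
    then have "(\<Sum>u\<in>V. pmf P u) = (\<Sum>u\<in>V. deg u) * r v"
      unfolding sum_distrib_right by (intro sum.cong) (auto simp: eq)
    moreover have "(\<Sum>u\<in>V. pmf P u) = 1"
      using sum_pmf_eq_1[OF finite_verts sub] .
    ultimately have "r v = 1 / (\<Sum>u\<in>V. deg u)"
      using sum_deg_pos by (simp add: field_simps)
    with eq[OF v] show "pmf P v = deg v / (\<Sum>u\<in>V. deg u)" by simp
  qed
next
  assume R: ?R
  show ?L
  proof (rule pmf_eqI)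
    fix v
    show "pmf (bind_pmf P (rw_step V E)) v = pmf P v"
    proof (cases "v \<in> V")
      case True
      have "(\<Sum>u\<in>N v. pmf P u / deg u) = (\<Sum>u\<in>N v. 1 / (\<Sum>u\<in>V. deg u))"
        using R neighbors_nonempty N_subset by (intro sum.cong refl) (auto simp: field_simps subset_iff)
      then show ?thesis using True R pmf_bind_rw_step[OF sub True] by simp
    next
      case False
      have "set_pmf (bind_pmf P (rw_step V E)) \<subseteq> V"
        using sub neighbors_nonempty N_subset unfolding set_bind_pmf rw_step_def
        by (intro UN_least) (metis finite_N set_pmf_of_set subsetD)
      with False sub show ?thesis
        by (metis pmf_eq_0_set_pmf subsetD)
    qed
  qed
qed

text \<open>Resolving the \<open>THE\<close> also needs existence: the normalised degrees are
  embedded as a pmf \<open>embed_pmf f\<close>, which \<open>stationary_iff\<close> shows to be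
  stationary and the only such pmf on \<open>V\<close>.\<close>

lemma pmf_stationary_distribution:
  assumes "v \<in> V"
  shows "pmf (stationary_distribution V E) v = deg v / (\<Sum>u\<in>V. deg u)"
proof -
  define f where "f v = (if v \<in> V then deg v / (\<Sum>u\<in>V. deg u) else 0)" for v
  have nonneg: "f v \<ge> 0" for v
    by (simp add: f_def sum_nonneg)
  have "(\<integral>\<^sup>+ v. f v \<partial>count_space UNIV) = (\<Sum>v\<in>V. ennreal (f v))"
    using finite_verts by (intro nn_integral_count_space'[of V]) (auto simp: f_def)
  also have "\<dots> = ennreal (\<Sum>v\<in>V. f v)"
    using nonneg by (simp add: sum_ennreal)
  also have "(\<Sum>v\<in>V. f v) = 1"
    using sum_deg_pos by (simp add: f_def sum_divide_distrib[symmetric])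
  finally have f: "pmf (embed_pmf f) v = f v" for v
    using nonneg by (intro pmf_embed_pmf) auto
  have set_f: "set_pmf (embed_pmf f) \<subseteq> V"
    by (auto simp: set_pmf_eq f f_def)
  have "\<exists>!P. set_pmf P \<subseteq> V \<and> bind_pmf P (rw_step V E) = P"
  proof (rule ex1I[of _ "embed_pmf f"])
    show "set_pmf (embed_pmf f) \<subseteq> V \<and> bind_pmf (embed_pmf f) (rw_step V E) = embed_pmf f"
      using set_f stationary_iff[OF set_f] by (simp add: f f_def)
  next
    fix P assume P: "set_pmf P \<subseteq> V \<and> bind_pmf P (rw_step V E) = P"
    show "P = embed_pmf f"
    proof (rule pmf_eqI)
      fix v show "pmf P v = pmf (embed_pmf f) v"
        using P stationary_iff[of P] by (cases "v \<in> V") (auto simp: f f_def set_pmf_eq)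
    qed
  qed
  from theI'[OF this] show ?thesis
    using assms stationary_iff unfolding stationary_distribution_def by blast
qed

end

section \<open>Kemeny's constant in terms of resistances\<close>

text \<open>
  In matrix form, with Laplacian \<open>L\<close>, the condition is \<open>L R = \<tau> 1\<^sup>T - 2 I\<close>.  Effective
  resistances satisfy it, and it is all that Kemeny's constant depends on.
\<close>

definition resistance_on :: "'a set \<Rightarrow> 'a set set \<Rightarrow> ('a \<Rightarrow> 'a \<Rightarrow> real) \<Rightarrow> bool" where
  "resistance_on V E R \<longleftrightarrow>
     (\<forall>i\<in>V. R i i = 0) \<and> (\<forall>i\<in>V. \<forall>j\<in>V. R i j = R j i) \<and>
     (\<exists>\<tau>. \<forall>i\<in>V. \<forall>j\<in>V. (\<Sum>u\<in>neighbors V E i. R i j - R u j) = \<tau> i - 2 * of_bool (i = j))"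

context connected_graph
begin

text \<open>The Laplacian condition makes Tetali's expression \<open>M\<close> solve the hitting
  time equations. Its average \<open>h\<close> over targets is harmonic on all of \<open>V\<close>,
  hence constant, which resolves the \<open>THE\<close>. Averaging \<open>h\<close> over starting
  vertices with degree weights produces \<open>S * W\<close> three times, with signs
  \<open>+\<close>, \<open>+\<close>, \<open>-\<close>.\<close>

theorem kemeny_resistance:
  assumes "resistance_on V E R"
  shows "kemeny V E = (\<Sum>i\<in>V. \<Sum>j\<in>V. deg i * deg j * R i j) / (2 * (\<Sum>i\<in>V. deg i))"
proof -
  from assms obtain \<tau> where diag: "\<And>i. i \<in> V \<Longrightarrow> R i i = 0"
    and sym: "\<And>i j. i \<in> V \<Longrightarrow> j \<in> V \<Longrightarrow> R i j = R j i"
    and lap: "\<And>i j. i \<in> V \<Longrightarrow> j \<in> V \<Longrightarrow> (\<Sum>u\<in>N i. R i j - R u j) = \<tau> i - 2 * of_bool (i = j)"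
    unfolding resistance_on_def by blast
  define W where "W = (\<Sum>i\<in>V. deg i)"
  have W: "W > 0" using sum_deg_pos by (simp add: W_def)
  \<comment> \<open>Tetali's formula for the expected hitting time of \<open>j\<close> from \<open>i\<close>\<close>
  define M where "M j i = (\<Sum>k\<in>V. deg k * (R i j + R j k - R i k)) / 2" for j i
  have M_diag: "M j j = 0" if "j \<in> V" for j
    using that by (simp add: M_def diag)
  have lap_M: "(\<Sum>u\<in>N i. M j i - M j u) = deg i - W * of_bool (i = j)" if "i \<in> V" "j \<in> V" for i j
  proof -
    have "(\<Sum>u\<in>N i. M j i - M j u) =
        (\<Sum>u\<in>N i. \<Sum>k\<in>V. deg k * ((R i j - R u j) - (R i k - R u k)) / 2)"
      unfolding M_def sum_divide_distrib sum_subtractf[symmetric]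
      by (intro sum.cong refl) (simp add: field_simps)
    also have "\<dots> = (\<Sum>k\<in>V. deg k * ((\<Sum>u\<in>N i. R i j - R u j) - (\<Sum>u\<in>N i. R i k - R u k)) / 2)"
      by (subst sum.swap) (simp add: sum_subtractf[symmetric] sum_distrib_left sum_divide_distrib)
    \<comment> \<open>The unknown \<open>\<tau> i\<close> cancels in the difference of the columns
      \<open>j\<close> and \<open>k\<close>.\<close>
    also have "\<dots> = (\<Sum>k\<in>V. (if k = i then deg k else 0) - deg k * of_bool (i = j))"
      using that by (intro sum.cong refl) (auto simp: lap field_simps)
    also have "\<dots> = deg i - W * of_bool (i = j)"
      using that finite_verts by (simp add: sum_subtractf W_def sum_distrib_right sum.delta)
    finally show ?thesis .
  qed
  have mfp: "mean_first_passage V E i j = M j i" if "i \<in> V" "j \<in> V" "i \<noteq> j" for i j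
    using that lap_M M_diag by (intro mean_first_passage_eqI) auto
  define h where "h i = (\<Sum>j\<in>V. deg j * M j i) / W" for i
  have h: "(\<Sum>j\<in>V-{i}. mean_first_passage V E i j * pmf (stationary_distribution V E) j) = h i"
    if "i \<in> V" for i
  proof -
    have "(\<Sum>j\<in>V-{i}. mean_first_passage V E i j * pmf (stationary_distribution V E) j)
        = (\<Sum>j\<in>V-{i}. deg j * M j i / W)"
      using that by (intro sum.cong refl) (auto simp: mfp pmf_stationary_distribution W_def)
    also have "\<dots> = (\<Sum>j\<in>V. deg j * M j i / W)"
      using that finite_verts M_diag by (intro sum.mono_neutral_left) auto
    finally show ?thesis by (simp add: h_def sum_divide_distrib)
  qed
  have h_harm: "deg i * h i = (\<Sum>u\<in>N i. h u)" if i: "i \<in> V" for i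
  proof -
    have "(\<Sum>u\<in>N i. h i - h u) = (\<Sum>u\<in>N i. \<Sum>j\<in>V. deg j * (M j i - M j u) / W)"
      unfolding h_def sum_divide_distrib sum_subtractf[symmetric]
      by (intro sum.cong refl) (simp add: right_diff_distrib diff_divide_distrib)
    also have "\<dots> = (\<Sum>j\<in>V. deg j * (\<Sum>u\<in>N i. M j i - M j u) / W)"
      by (subst sum.swap) (simp add: sum_distrib_left sum_divide_distrib)
    also have "\<dots> = (\<Sum>j\<in>V. deg i * deg j / W - (if j = i then deg j else 0))"
      using i W by (intro sum.cong refl) (auto simp: lap_M field_simps)
    also have "\<dots> = 0"
      using i W finite_verts
      by (simp add: sum_subtractf sum.delta sum_distrib_left[symmetric] sum_divide_distrib[symmetric]
          W_def[symmetric])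
    finally show ?thesis by (simp add: sum_subtractf)
  qed
  have h_const: "h i = h j" if "i \<in> V" "j \<in> V" for i j
    using h_harm by (intro harmonic_off_point_const[OF that(2) _ that(1)])
  obtain v where v: "v \<in> V" using verts_nonempty by blast
  have kem: "kemeny V E = h v"
    unfolding kemeny_def
  proof (rule the_equality)
    show "\<forall>i\<in>V. h v = (\<Sum>j\<in>V-{i}.
        mean_first_passage V E i j * pmf (stationary_distribution V E) j)"
      using h_const[OF v] by (simp add: h)
  qed (use v in \<open>simp add: h[OF v, symmetric]\<close>)
  define S where "S = (\<Sum>i\<in>V. \<Sum>j\<in>V. deg i * deg j * R i j)"
  have "W * h v = (\<Sum>i\<in>V. deg i * h i)"
    unfolding W_def sum_distrib_right using h_const[OF v] by (intro sum.cong refl) metis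
  also have "\<dots> = (\<Sum>i\<in>V. \<Sum>j\<in>V. \<Sum>k\<in>V. deg i * deg j * deg k * (R i j + R j k - R i k)) / (2 * W)"
    unfolding h_def M_def sum_distrib_left sum_divide_distrib
    by (intro sum.cong refl) (simp add: mult_ac)
  also have "(\<Sum>i\<in>V. \<Sum>j\<in>V. \<Sum>k\<in>V. deg i * deg j * deg k * (R i j + R j k - R i k)) =
      (\<Sum>i\<in>V. \<Sum>j\<in>V. \<Sum>k\<in>V. deg i * deg j * R i j * deg k)
      + (\<Sum>i\<in>V. \<Sum>j\<in>V. \<Sum>k\<in>V. deg i * (deg j * deg k * R j k))
      - (\<Sum>i\<in>V. \<Sum>j\<in>V. \<Sum>k\<in>V. deg j * (deg i * deg k * R i k))"
    by (simp add: sum.distrib sum_subtractf algebra_simps)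
  also have "(\<Sum>i\<in>V. \<Sum>j\<in>V. \<Sum>k\<in>V. deg i * deg j * R i j * deg k) = S * W"
    by (simp add: S_def W_def sum_distrib_left[symmetric] sum_distrib_right[symmetric])
  also have "(\<Sum>i\<in>V. \<Sum>j\<in>V. \<Sum>k\<in>V. deg i * (deg j * deg k * R j k)) = S * W"
    by (simp add: S_def W_def sum_distrib_left[symmetric] sum_distrib_right[symmetric] mult.commute)
  also have "(\<Sum>i\<in>V. \<Sum>j\<in>V. \<Sum>k\<in>V. deg j * (deg i * deg k * R i k)) = S * W"
    by (subst sum.swap) (simp add: S_def W_def sum_distrib_left[symmetric] sum_distrib_right[symmetric] mult.commute)
  finally have "h v = S / (2 * W)"
    using W by (simp add: field_simps)
  then show ?thesis
    by (simp add: kem S_def W_def)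
qed

end

section \<open>Adding an edge\<close>

lemma neighbors_insert:
  assumes "a \<in> V" "b \<in> V"
  shows "neighbors V (insert {a, b} E) i =
    neighbors V E i \<union> (if i = a then {b} else {}) \<union> (if i = b then {a} else {})"
  using assms by (auto simp: neighbors_def doubleton_eq_iff)

text \<open>
  Here \<open>t\<close> is the potential of a unit current entering at \<open>b\<close> and leaving at \<open>a\<close>; the update of
  \<open>R\<close> is the Sherman--Morrison formula.
\<close>

lemma resistance_on_insert:
  fixes R :: "'a \<Rightarrow> 'a \<Rightarrow> real"
  assumes fin: "finite V" and res: "resistance_on V E R"
    and ab: "a \<in> V" "b \<in> V" "a \<noteq> b" "{a, b} \<notin> E" and pos: "1 + R a b \<noteq> 0"
  defines "t \<equiv> \<lambda>j. (R a j - R b j + R a b) / 2"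
  shows "resistance_on V (insert {a, b} E) (\<lambda>x y. R x y - (t x - t y)\<^sup>2 / (1 + R a b))"
proof -
  from res obtain \<tau> where diag: "\<And>i. i \<in> V \<Longrightarrow> R i i = 0"
    and sym: "\<And>i j. i \<in> V \<Longrightarrow> j \<in> V \<Longrightarrow> R i j = R j i"
    and lap: "\<And>i j. i \<in> V \<Longrightarrow> j \<in> V \<Longrightarrow>
        (\<Sum>u\<in>neighbors V E i. R i j - R u j) = \<tau> i - 2 * of_bool (i = j)"
    unfolding resistance_on_def by blast
  have N_sub: "neighbors V E i \<subseteq> V" for i by (auto simp: neighbors_def)
  have fin_N: "finite (neighbors V E i)" for i using finite_subset[OF N_sub fin] .
  define l c where "l = R a b" and "c = 1 + l"
  have c: "c \<noteq> 0" using pos by (simp add: c_def l_def)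
  have ta: "t a = 0" and tb: "t b = l"
    using ab sym[of a b] by (auto simp: t_def diag l_def)
  define R' where "R' = (\<lambda>x y. R x y - (t x - t y)\<^sup>2 / c)"
  define \<sigma> where "\<sigma> i = \<tau> i - ((\<Sum>u\<in>neighbors V E i. (t i)\<^sup>2 - (t u)\<^sup>2)
      + l * (of_bool (i = a) - of_bool (i = b))) / c" for i
  have "(\<Sum>u\<in>neighbors V (insert {a, b} E) i. R' i j - R' u j) = \<sigma> i - 2 * of_bool (i = j)"
    if i: "i \<in> V" and j: "j \<in> V" for i j
  proof -
    have "(\<Sum>u\<in>neighbors V E i. t i - t u) =
        (\<Sum>u\<in>neighbors V E i. ((R i a - R u a) - (R i b - R u b)) / 2)"
      unfolding t_def using i ab N_sub sym
      by (intro sum.cong refl) (smt (verit, best) add_divide_distrib diff_divide_distrib in_mono)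
    also have "\<dots> = of_bool (i = b) - of_bool (i = a)"
      unfolding sum_divide_distrib[symmetric]
        sum_subtractf[of "\<lambda>u. R i a - R u a" "\<lambda>u. R i b - R u b"] lap[OF i ab(1)] lap[OF i ab(2)]
      by simp
    finally have lap_t: "(\<Sum>u\<in>neighbors V E i. t i - t u) = of_bool (i = b) - of_bool (i = a)" .
    have "(\<Sum>u\<in>neighbors V E i. R' i j - R' u j) =
        (\<Sum>u\<in>neighbors V E i. (R i j - R u j) - (((t i)\<^sup>2 - (t u)\<^sup>2) - 2 * t j * (t i - t u)) / c)"
      unfolding R'_def by (intro sum.cong refl) (simp add: power2_eq_square field_simps c)
    also have "\<dots> = (\<tau> i - 2 * of_bool (i = j)) -
        ((\<Sum>u\<in>neighbors V E i. (t i)\<^sup>2 - (t u)\<^sup>2) - 2 * t j * (of_bool (i = b) - of_bool (i = a))) / c"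
      unfolding sum_subtractf[of "\<lambda>u. R i j - R u j"] lap[OF i j] sum_divide_distrib[symmetric]
        sum_subtractf[of "\<lambda>u. (t i)\<^sup>2 - (t u)\<^sup>2"] sum_distrib_left[symmetric] lap_t ..
    finally have old: "(\<Sum>u\<in>neighbors V E i. R' i j - R' u j) = (\<tau> i - 2 * of_bool (i = j)) -
        ((\<Sum>u\<in>neighbors V E i. (t i)\<^sup>2 - (t u)\<^sup>2) - 2 * t j * (of_bool (i = b) - of_bool (i = a))) / c" .
    have "R a j - R b j = 2 * t j - l" by (simp add: t_def l_def field_simps)
    moreover have "R' a j - R' b j = (R a j - R b j) - (2 * l * t j - l\<^sup>2) / c"
      unfolding R'_def ta tb by (simp add: power2_eq_square field_simps c)
    ultimately have "R' a j - R' b j = (2 * t j - l) - (2 * l * t j - l\<^sup>2) / c"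
      by simp
    also have "\<dots> = (2 * t j - l) / c"
      using c by (simp add: field_simps) (simp add: c_def power2_eq_square algebra_simps)
    finally have new: "R' a j - R' b j = (2 * t j - l) / c" .
    have "b \<notin> neighbors V E a" "a \<notin> neighbors V E b"
      using ab by (auto simp: neighbors_def insert_commute)
    then have "(\<Sum>u\<in>neighbors V (insert {a, b} E) i. R' i j - R' u j) =
        (\<Sum>u\<in>neighbors V E i. R' i j - R' u j)
        + (of_bool (i = a) - of_bool (i = b)) * (R' a j - R' b j)"
      using ab fin_N by (auto simp: neighbors_insert)
    \<comment> \<open>The terms with \<open>t j\<close> in \<open>old\<close> and in
      \<open>new\<close> cancel; what remains besides \<open>2 * of_bool (i = j)\<close> depends on
      \<open>i\<close> only and is \<open>\<sigma> i\<close>.\<close>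
    also have "\<dots> = \<sigma> i - 2 * of_bool (i = j)"
      unfolding old new \<sigma>_def using ab(3) c by (auto simp: field_simps)
    finally show ?thesis .
  qed
  moreover have "R' i i = 0" if "i \<in> V" for i using that by (simp add: R'_def diag)
  moreover have "R' i j = R' j i" if "i \<in> V" "j \<in> V" for i j
    using that by (simp add: R'_def sym power2_commute)
  ultimately have "resistance_on V (insert {a, b} E) R'"
    unfolding resistance_on_def by blast
  then show ?thesis by (simp add: R'_def c_def l_def)
qed

context connected_graph
begin

lemma connected_graph_insert:
  assumes "a \<in> V" "b \<in> V"
  shows "connected_graph V (insert {a, b} E)"
proof
  fix U assume U: "U \<subseteq> V" "U \<noteq> {}" "\<And>u. u \<in> U \<Longrightarrow> neighbors V (insert {a, b} E) u \<subseteq> U"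
  then have "\<And>u. u \<in> U \<Longrightarrow> N u \<subseteq> U"
    unfolding neighbors_insert[OF assms] by blast
  with U show "U = V" by (intro closed_eq_verts)
qed (use finite_verts verts_nonempty neighbors_nonempty neighbors_insert[OF assms] in auto)

text \<open>Write \<open>S / (2 * W)\<close> for the old value. The new edge changes the numerator
  by the large bracket \<open>Y\<close> on the right, where the last term is the rank-one
  correction, and turns \<open>W\<close> into \<open>W + 2\<close>. Cross-multiplying
  \<open>S / W < (S + Y) / (W + 2)\<close> leaves \<open>2 * S < W * Y\<close>.\<close>

lemma kemeny_less_insert_iff:
  fixes R :: "'a \<Rightarrow> 'a \<Rightarrow> real"
  assumes res: "resistance_on V E R"
    and ab: "a \<in> V" "b \<in> V" "a \<noteq> b" "{a, b} \<notin> E" and pos: "1 + R a b \<noteq> 0"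
  defines "t \<equiv> \<lambda>j. (R a j - R b j + R a b) / 2"
    and "d' \<equiv> \<lambda>i. deg i + of_bool (i = a) + of_bool (i = b)"
  shows "kemeny V E < kemeny V (insert {a, b} E) \<longleftrightarrow>
    2 * (\<Sum>i\<in>V. \<Sum>j\<in>V. deg i * deg j * R i j) <
      (\<Sum>i\<in>V. deg i) *
      (2 * (\<Sum>j\<in>V. deg j * R a j) + 2 * (\<Sum>j\<in>V. deg j * R b j) + 2 * R a b
        - (\<Sum>i\<in>V. \<Sum>j\<in>V. d' i * d' j * (t i - t j)\<^sup>2) / (1 + R a b))"
proof -
  interpret G': connected_graph V "insert {a, b} E"
    using connected_graph_insert ab by blast
  have diag: "R i i = 0" if "i \<in> V" for i using that res by (auto simp: resistance_on_def)
  have sym: "R i j = R j i" if "i \<in> V" "j \<in> V" for i j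
    using that res unfolding resistance_on_def by blast
  have deg': "G'.deg i = d' i" for i
  proof -
    have "b \<notin> N a" "a \<notin> N b"
      using ab by (auto simp: neighbors_def insert_commute)
    then show ?thesis
      using ab(3) unfolding d'_def neighbors_insert[OF ab(1,2)] by auto
  qed
  define W S Q where "W = (\<Sum>i\<in>V. deg i)" and "S = (\<Sum>i\<in>V. \<Sum>j\<in>V. deg i * deg j * R i j)"
    and "Q = (\<Sum>i\<in>V. \<Sum>j\<in>V. d' i * d' j * (t i - t j)\<^sup>2) / (1 + R a b)"
  define X where "X x = (\<Sum>j\<in>V. deg j * R x j)" for x
  have pick: "(\<Sum>i\<in>V. of_bool (i = x) * f i) = f x" if "x \<in> V" for x and f :: "'a \<Rightarrow> real"
    using that finite_verts by (simp add: of_bool_def if_distrib[of "\<lambda>x. x * _"] cong: if_cong)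
  have row: "(\<Sum>j\<in>V. d' j * R i j) = X i + R i a + R i b" for i
    by (simp add: d'_def distrib_right sum.distrib X_def pick[OF ab(1)] pick[OF ab(2)])
  have X_sym: "(\<Sum>i\<in>V. deg i * R i x) = X x" if "x \<in> V" for x
    unfolding X_def using that sym by (intro sum.cong) auto
  have S_X: "S = (\<Sum>i\<in>V. deg i * X i)"
    by (simp add: S_def X_def sum_distrib_left mult.assoc)
  have "(\<Sum>i\<in>V. \<Sum>j\<in>V. d' i * d' j * R i j) = (\<Sum>i\<in>V. d' i * (X i + R i a + R i b))"
    by (simp add: row[symmetric] sum_distrib_left mult.assoc)
  also have "\<dots> = (\<Sum>i\<in>V. deg i * X i) + (\<Sum>i\<in>V. deg i * R i a) + (\<Sum>i\<in>V. deg i * R i b)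
      + (X a + R a a + R a b) + (X b + R b a + R b b)"
    unfolding d'_def
    by (simp add: distrib_right sum.distrib pick[OF ab(1)] pick[OF ab(2)]) (simp add: distrib_left sum.distrib)
  also have "\<dots> = S + 2 * X a + 2 * X b + 2 * R a b"
    using ab by (simp add: S_X X_sym diag sym[of b a])
  finally have S'1: "(\<Sum>i\<in>V. \<Sum>j\<in>V. d' i * d' j * R i j) = S + 2 * X a + 2 * X b + 2 * R a b" .
  have "(\<Sum>i\<in>V. \<Sum>j\<in>V. d' i * d' j * (R i j - (t i - t j)\<^sup>2 / (1 + R a b)))
      = (\<Sum>i\<in>V. \<Sum>j\<in>V. d' i * d' j * R i j) - Q"
    unfolding Q_def sum_divide_distrib sum_subtractf[symmetric]
    by (intro sum.cong refl) (simp add: algebra_simps)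
  then have S': "(\<Sum>i\<in>V. \<Sum>j\<in>V. d' i * d' j * (R i j - (t i - t j)\<^sup>2 / (1 + R a b)))
      = S + (2 * X a + 2 * X b + 2 * R a b - Q)"
    by (simp add: S'1)
  have W': "(\<Sum>i\<in>V. d' i) = W + 2"
    using ab finite_verts by (simp add: d'_def sum.distrib W_def of_bool_def)
  have W: "W > 0" using sum_deg_pos by (simp add: W_def)
  have "kemeny V E = S / (2 * W)"
    unfolding kemeny_resistance[OF res] by (simp add: S_def W_def)
  moreover have "kemeny V (insert {a, b} E) = (S + (2 * X a + 2 * X b + 2 * R a b - Q)) / (2 * (W + 2))"
    unfolding G'.kemeny_resistance[OF resistance_on_insert[where R = R, OF finite_verts res ab pos]]
    unfolding deg' W' S'[unfolded t_def] ..
  moreover have frac_less_iff: "S / (2 * W) < (S + Y) / (2 * (W + 2)) \<longleftrightarrow> 2 * S < W * Y" for Y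
  proof -
    have "S / (2 * W) * (2 * (W + 2)) = S + 2 * S / W"
      using W by (simp add: field_simps)
    then have "S / (2 * W) < (S + Y) / (2 * (W + 2)) \<longleftrightarrow> 2 * S / W < Y"
      using W by (subst pos_less_divide_eq) auto
    then show ?thesis using W by (simp add: pos_divide_less_eq mult.commute)
  qed
  ultimately show ?thesis
    unfolding S_def[symmetric] W_def[symmetric] Q_def[symmetric] X_def[symmetric]
    by (simp only: frac_less_iff)
qed

end

section \<open>Two facts on finite sums\<close>

lemma double_sum_restrict_le:
  fixes f :: "'a \<Rightarrow> 'a \<Rightarrow> real"
  assumes "finite V" "A \<subseteq> V" "B \<subseteq> V" "\<And>i j. i \<in> V \<Longrightarrow> j \<in> V \<Longrightarrow> f i j \<ge> 0"
  shows "(\<Sum>i\<in>A. \<Sum>j\<in>B. f i j) \<le> (\<Sum>i\<in>V. \<Sum>j\<in>V. f i j)"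
proof -
  have "(\<Sum>i\<in>A. \<Sum>j\<in>B. f i j) \<le> (\<Sum>i\<in>A. \<Sum>j\<in>V. f i j)"
    using assms by (intro sum_mono sum_mono2) auto
  also have "\<dots> \<le> (\<Sum>i\<in>V. \<Sum>j\<in>V. f i j)"
    using assms by (intro sum_mono2 sum_nonneg) auto
  finally show ?thesis .
qed

lemma sum_abs_diff:
  fixes x k :: nat
  assumes "1 \<le> x" "x \<le> k"
  shows "2 * (\<Sum>y=1..k. \<bar>real x - real y\<bar>) =
    real x * (real x - 1) + (real k - real x) * (real k - real x + 1)"
  using assms(2)
proof (induction k rule: dec_induct)
  case base
  have "2 * (\<Sum>y=1..n. real x - real y) = real n * (2 * real x - real n - 1)" for n
    by (induction n) (auto simp: algebra_simps)
  from this[of x] show ?case by (simp add: algebra_simps)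
next
  case (step n)
  then have "\<bar>real x - real (Suc n)\<bar> = real n + 1 - real x" by simp
  with step show ?case using assms(1) by (simp add: algebra_simps)
qed

section \<open>Brooms\<close>

locale broom =
  fixes k p :: nat
  assumes k_ge: "k \<ge> 3" and p_ge: "p \<ge> 1"
begin

abbreviation "V \<equiv> broom_verts k p"
abbreviation "E \<equiv> broom_edges k p"

section \<open>Adjacency, connectedness and degrees\<close>

lemma edge_iff:
  "{x, y} \<in> E \<longleftrightarrow> (1 \<le> x \<and> x < k \<and> y = x + 1) \<or> (1 \<le> y \<and> y < k \<and> x = y + 1)
     \<or> (x = k \<and> k < y \<and> y \<le> k + p) \<or> (y = k \<and> k < x \<and> x \<le> k + p)"
proof -
  have "{x, y} \<in> {{k, k + l} | l. 1 \<le> l \<and> l \<le> p} \<longleftrightarrow>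
      (x = k \<and> k < y \<and> y \<le> k + p) \<or> (y = k \<and> k < x \<and> x \<le> k + p)"
  proof
    assume "(x = k \<and> k < y \<and> y \<le> k + p) \<or> (y = k \<and> k < x \<and> x \<le> k + p)"
    then show "{x, y} \<in> {{k, k + l} | l. 1 \<le> l \<and> l \<le> p}"
    proof
      assume "x = k \<and> k < y \<and> y \<le> k + p"
      then show ?thesis by (auto intro!: exI[of _ "y - k"])
    next
      assume "y = k \<and> k < x \<and> x \<le> k + p"
      then show ?thesis by (auto simp: insert_commute intro!: exI[of _ "x - k"])
    qed
  qed (auto simp: doubleton_eq_iff)
  moreover have "{x, y} \<in> {{i, i + 1} | i. 1 \<le> i \<and> i < k} \<longleftrightarrow>
      (1 \<le> x \<and> x < k \<and> y = x + 1) \<or> (1 \<le> y \<and> y < k \<and> x = y + 1)"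
    by (auto simp: doubleton_eq_iff)
  ultimately show ?thesis by (simp add: broom_edges_def)
qed

lemma neighbors_1: "neighbors V E 1 = {2}"
  using k_ge by (auto simp: neighbors_def edge_iff broom_verts_def)

lemma neighbors_inner: "1 < x \<Longrightarrow> x < k \<Longrightarrow> neighbors V E x = {x - 1, x + 1}"
  by (auto simp: neighbors_def edge_iff broom_verts_def)

lemma neighbors_k: "neighbors V E k = insert (k - 1) {k + 1..k + p}"
  using k_ge by (auto simp: neighbors_def edge_iff broom_verts_def)

lemma neighbors_leaf: "k < x \<Longrightarrow> x \<le> k + p \<Longrightarrow> neighbors V E x = {k}"
  using k_ge by (auto simp: neighbors_def edge_iff broom_verts_def)

lemma vert_cases:
  assumes "x \<in> V"
  obtains "x = 1" | "1 < x" "x < k" | "x = k" | "k < x" "x \<le> k + p"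
  using assms by (force simp: broom_verts_def)

sublocale connected_graph V E
proof
  fix i assume "i \<in> V"
  then show "neighbors V E i \<noteq> {}"
    by (cases rule: vert_cases)
       (auto simp: neighbors_1 neighbors_inner neighbors_k neighbors_leaf simp del: One_nat_def)
next
  fix U assume U: "U \<subseteq> V" "U \<noteq> {}" and closed: "\<And>u. u \<in> U \<Longrightarrow> neighbors V E u \<subseteq> U"
  have adj: "y \<in> U" if "x \<in> U" "y \<in> V" "{x, y} \<in> E" for x y
    using closed[OF that(1)] that by (auto simp: neighbors_def)
  obtain x where x: "x \<in> U" using U by blast
  then have "x \<in> V" using U by blast
  \<comment> \<open>A closed set contains the centre \<open>k\<close>, reached along the path or
    from a leaf, and from \<open>k\<close> every other vertex is reached.\<close>
  have "k \<in> U"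
  proof (cases "x \<le> k")
    case True
    have "y \<in> U" if "x \<le> y" "y \<le> k" for y
      using that
    proof (induction y rule: dec_induct)
      case base show ?case by (rule x)
    next
      case (step y)
      have "x \<ge> 1" using \<open>x \<in> V\<close> by (simp add: broom_verts_def)
      with step show ?case
        by (intro adj[of y "Suc y"]) (auto simp: edge_iff broom_verts_def)
    qed
    with True show ?thesis by simp
  next
    case False
    with x \<open>x \<in> V\<close> k_ge show ?thesis
      by (intro adj[of x k]) (auto simp: edge_iff broom_verts_def)
  qed
  have "y \<in> U" if "y \<le> k" "1 \<le> y" for y
    using that
  proof (induction y rule: inc_induct)
    case base show ?case by (rule \<open>k \<in> U\<close>)
  next
    case (step y)
    then show ?case
      by (intro adj[of "Suc y" y]) (auto simp: edge_iff broom_verts_def)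
  qed
  moreover have "y \<in> U" if "k < y" "y \<le> k + p" for y
    using \<open>k \<in> U\<close> that by (intro adj[of k y]) (auto simp: edge_iff broom_verts_def)
  ultimately have "y \<in> U" if "y \<in> V" for y
    using that by (cases "y \<le> k") (auto simp: broom_verts_def)
  with U show "U = V" by blast
qed (use k_ge in \<open>auto simp: broom_verts_def\<close>)

definition d :: "nat \<Rightarrow> real" where
  "d x = (if x = 1 then 1 else if x < k then 2 else if x = k then real p + 1 else 1)"

lemma deg_eq:
  assumes "x \<in> V"
  shows "deg x = d x"
  using assms
  by (cases rule: vert_cases)
     (use k_ge in \<open>auto simp: neighbors_1 neighbors_inner neighbors_k neighbors_leaf d_def
        simp del: One_nat_def\<close>)

section \<open>Distances and their degree-weighted sums\<close>

text \<open>
  The graph distance: leaves have height \<open>k + 1\<close>, and the second summand corrects the distance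
  between two different leaves.
\<close>

definition D :: "nat \<Rightarrow> nat \<Rightarrow> real" where
  "D x y = \<bar>real (min x (k + 1)) - real (min y (k + 1))\<bar> + 2 * of_bool (k < x \<and> k < y \<and> x \<noteq> y)"

lemma D_path: "x \<le> k \<Longrightarrow> y \<le> k \<Longrightarrow> D x y = \<bar>real x - real y\<bar>"
  by (simp add: D_def)

lemma D_path_leaf: "x \<le> k \<Longrightarrow> k < y \<Longrightarrow> D x y = real k + 1 - real x"
  by (simp add: D_def)

lemma D_leaf_path: "k < x \<Longrightarrow> y \<le> k \<Longrightarrow> D x y = real k + 1 - real y"
  by (simp add: D_def)

lemma D_leaf: "k < x \<Longrightarrow> k < y \<Longrightarrow> D x y = 2 * of_bool (x \<noteq> y)"
  by (simp add: D_def)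

lemmas D_simps = D_path D_path_leaf D_leaf_path D_leaf

text \<open>The broom is a tree. A vertex \<open>i \<noteq> j\<close> has exactly one neighbour
  closer to \<open>j\<close>, and its other \<open>d i - 1\<close> neighbours are farther by 1,
  which gives \<open>2 - d i\<close>. At \<open>i = j\<close> all neighbours are farther, which
  gives \<open>- d i\<close>.\<close>

lemma laplacian_D:
  assumes i: "i \<in> V" and j: "j \<in> V"
  shows "(\<Sum>u\<in>neighbors V E i. D i j - D u j) = (2 - d i) - 2 * of_bool (i = j)"
  using i
proof (cases rule: vert_cases)
  case 1
  then show ?thesis
    using k_ge j unfolding neighbors_1[folded 1]
    by (cases "j \<le> k") (auto simp: D_simps d_def broom_verts_def)
next
  case 2
  then show ?thesis
    using k_ge j unfolding neighbors_inner[OF 2]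
    by (cases "j \<le> k") (auto simp: D_simps d_def broom_verts_def of_nat_diff abs_if)
next
  case 3
  have "(\<Sum>u\<in>neighbors V E i. D i j - D u j) =
      (D k j - D (k - 1) j) + (\<Sum>u=k+1..k+p. D k j - D u j)"
    using 3 neighbors_k by simp
  also have "(\<Sum>u=k+1..k+p. D k j - D u j) = (if k < j then 2 else 0) - real p"
  proof (cases "k < j")
    case True
    then have "(\<Sum>u=k+1..k+p. D k j - D u j) = (\<Sum>u=k+1..k+p. (if u = j then 2 else 0) - 1)"
      by (intro sum.cong refl) (auto simp: D_simps)
    also have "\<dots> = 2 - real p"
      using True j by (simp add: sum_subtractf broom_verts_def)
    finally show ?thesis using True by simp
  next
    case False
    then have "(\<Sum>u=k+1..k+p. D k j - D u j) = (\<Sum>u=k+1..k+p. -1)"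
      by (intro sum.cong refl) (auto simp: D_simps)
    then show ?thesis using False by simp
  qed
  finally show ?thesis
    using 3 k_ge j by (cases "j \<le> k") (auto simp: D_simps d_def broom_verts_def of_nat_diff)
next
  case 4
  then show ?thesis
    using k_ge j unfolding neighbors_leaf[OF 4]
    by (cases "j \<le> k") (auto simp: D_simps d_def broom_verts_def)
qed

lemma resistance_on_D: "resistance_on V E D"
  unfolding resistance_on_def using laplacian_D
  by (intro conjI exI[of _ "\<lambda>i. 2 - d i"]) (auto simp: D_def abs_minus_commute)

text \<open>Every path vertex is counted with degree 2; the ends \<open>1\<close> and
  \<open>k\<close> are then corrected by \<open>- 1\<close> and \<open>p - 1\<close>.\<close>

lemma sum_d: "(\<Sum>y\<in>V. d y * f y) =
    2 * (\<Sum>y=1..k. f y) - f 1 + (real p - 1) * f k + (\<Sum>y=k+1..k+p. f y)"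
proof -
  have "V = {1..k} \<union> {k+1..k+p}" by (auto simp: broom_verts_def)
  then have "(\<Sum>y\<in>V. d y * f y) = (\<Sum>y=1..k. d y * f y) + (\<Sum>y=k+1..k+p. d y * f y)"
    by (simp add: sum.union_disjoint)
  also have "(\<Sum>y=k+1..k+p. d y * f y) = (\<Sum>y=k+1..k+p. f y)"
    using k_ge by (intro sum.cong refl) (auto simp: d_def)
  also have "(\<Sum>y=1..k. d y * f y) =
      (\<Sum>y=1..k. 2 * f y - (if y = 1 then f y else 0) + (if y = k then (real p - 1) * f y else 0))"
    using k_ge by (intro sum.cong refl) (auto simp: d_def algebra_simps)
  also have "\<dots> = 2 * (\<Sum>y=1..k. f y) - f 1 + (real p - 1) * f k"
    using k_ge by (simp add: sum.distrib sum_subtractf sum_distrib_left)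
  finally show ?thesis by simp
qed

lemma sum_d_eq: "(\<Sum>y\<in>V. d y) = 2 * (real k + real p - 1)"
  using sum_d[of "\<lambda>_. 1"] by simp

lemma d_ge_1: "d x \<ge> 1"
  using p_ge by (simp add: d_def)

definition X :: "nat \<Rightarrow> real" where "X x = (\<Sum>y\<in>V. d y * D x y)"

lemma X_path:
  assumes "1 \<le> x" "x \<le> k"
  shows "X x = (real x - 1)\<^sup>2 + (real k - real x)\<^sup>2 + real p * (2 * (real k - real x) + 1)"
proof -
  have "(\<Sum>y=1..k. D x y) = (\<Sum>y=1..k. \<bar>real x - real y\<bar>)"
    using assms by (intro sum.cong refl) (auto simp: D_path)
  moreover have "(\<Sum>y=k+1..k+p. D x y) = (\<Sum>y=k+1..k+p. real k + 1 - real x)"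
    using assms by (intro sum.cong refl) (auto simp: D_path_leaf)
  moreover have "D x 1 = real x - 1" "D x k = real k - real x"
    using assms k_ge by (auto simp: D_path)
  ultimately have "X x = 2 * (\<Sum>y=1..k. \<bar>real x - real y\<bar>) - (real x - 1)
      + (real p - 1) * (real k - real x) + real p * (real k + 1 - real x)"
    unfolding X_def sum_d by simp
  then show ?thesis
    unfolding sum_abs_diff[OF assms] by (simp add: power2_eq_square algebra_simps)
qed

lemma X_1: "X 1 = (real k - 1)\<^sup>2 + real p * (2 * real k - 1)"
  using k_ge by (simp add: X_path algebra_simps)

text \<open>Up to an additive 2, the free end \<open>1\<close> maximises \<open>X\<close>. This
  bounds the left side of \<open>braess_iff\<close> by a multiple of \<open>X 1\<close>. On the path
  it follows from the closed form; a leaf is compared with its neighbour \<open>k\<close>.\<close>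

lemma X_le:
  assumes "x \<in> V"
  shows "X x \<le> X 1 + 2"
proof (cases "x \<le> k")
  case True
  with assms have x: "1 \<le> x" by (simp add: broom_verts_def)
  have "(real x - 1)\<^sup>2 + (real k - real x)\<^sup>2 \<le> (real k - 1)\<^sup>2"
  proof -
    have "0 \<le> 2 * ((real x - 1) * (real k - real x))" using x True by simp
    then show ?thesis by (simp add: power2_eq_square algebra_simps)
  qed
  moreover have "real p * (2 * (real k - real x) + 1) \<le> real p * (2 * real k - 1)"
    using x by (intro mult_left_mono) auto
  ultimately show ?thesis
    unfolding X_1 X_path[OF x True] by linarith
next
  case False
  have "X x \<le> (\<Sum>y\<in>V. d y * (D k y + 1))"
    unfolding X_def
  proof (intro sum_mono mult_left_mono)
    show "D x y \<le> D k y + 1" for y using False by (cases "y \<le> k") (auto simp: D_simps)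
    show "0 \<le> d y" for y using d_ge_1[of y] by simp
  qed
  also have "\<dots> = X k + 2 * (real k + real p - 1)"
    by (simp add: distrib_left sum.distrib X_def sum_d_eq)
  also have "\<dots> = (real k - 1)\<^sup>2 + real p + 2 * (real k + real p - 1)"
    using k_ge by (simp add: X_path)
  also have "\<dots> \<le> X 1 + 2"
  proof -
    \<comment> \<open>This product is exactly the difference of the two sides.\<close>
    have "0 \<le> 2 * ((real p - 1) * (real k - 2))" using k_ge p_ge by simp
    then show ?thesis unfolding X_1 by (simp add: algebra_simps)
  qed
  finally show ?thesis .
qed

text \<open>The triangle inequality, weighted by a total degree below \<open>2 * (k + p)\<close>:
  near the free end \<open>X\<close> is almost as large as \<open>X 1\<close>.\<close>

lemma X_1_le:
  assumes "x \<le> k" "1 \<le> x"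
  shows "X 1 \<le> X x + 2 * real x * real (k + p)"
proof -
  have "X 1 \<le> (\<Sum>y\<in>V. d y * (D x y + real x))"
    unfolding X_def
  proof (intro sum_mono mult_left_mono)
    show "D 1 y \<le> D x y + real x" for y
      using k_ge assms by (cases "y \<le> k") (auto simp: D_simps)
    show "0 \<le> d y" for y using d_ge_1[of y] by simp
  qed
  also have "\<dots> = X x + 2 * (real k + real p - 1) * real x"
    unfolding distrib_left sum.distrib sum_distrib_right[symmetric] sum_d_eq X_def ..
  also have "\<dots> \<le> X x + 2 * real x * real (k + p)"
    by (simp add: algebra_simps)
  finally show ?thesis .
qed

lemma X_path_le:
  assumes "x \<le> k" "1 \<le> x"
  shows "X x \<le> 2 * real k * real (k + p)"
proof -
  have "X x \<le> (\<Sum>y\<in>V. d y * real k)"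
    unfolding X_def
  proof (intro sum_mono mult_left_mono)
    show "D x y \<le> real k" if "y \<in> V" for y
      using k_ge assms that by (cases "y \<le> k") (auto simp: D_simps broom_verts_def)
    show "0 \<le> d y" for y using d_ge_1[of y] by simp
  qed
  also have "\<dots> = 2 * (real k + real p - 1) * real k"
    unfolding sum_distrib_right[symmetric] sum_d_eq ..
  also have "\<dots> \<le> 2 * real k * real (k + p)"
    by (simp add: algebra_simps)
  finally show ?thesis .
qed

lemma X_1_ge: "X 1 \<ge> real k * real (k + p) / 3"
proof -
  have "0 \<le> real k * (real k - 3)" "0 \<le> real p * (real k - 3)" "0 \<le> real p" using k_ge by auto
  moreover have "X 1 - real k * real (k + p) / 3 =
      2 / 3 * (real k * (real k - 3)) + 5 / 3 * (real p * (real k - 3)) + 4 * real p + 1"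
    unfolding X_1 by (simp add: power2_eq_square field_simps)
  ultimately show ?thesis by linarith
qed

section \<open>Gain and loss of a path edge\<close>

text \<open>In a tree a unit current between \<open>a\<close> and \<open>b\<close> uses only the
  path between them, so the potential is linear there and constant beyond each end, also on the
  leaves.\<close>

lemma path_edge_potential:
  assumes "a < b" "b \<le> k"
  shows "(D a j - D b j + D a b) / 2 = real (min (max j a) b) - real a"
  using assms by (cases "j \<le> k") (auto simp: D_simps min_def max_def)

text \<open>
  Clamping to \<open>[a, b]\<close> gives the potential \<open>t\<close> of the rank-one update up to the constant \<open>a\<close>.
\<close>

definition Q :: "nat \<Rightarrow> nat \<Rightarrow> real" where
  "Q a b = (\<Sum>i\<in>V. \<Sum>j\<in>V. (d i + of_bool (i = a) + of_bool (i = b)) *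
      (d j + of_bool (j = a) + of_bool (j = b)) *
      (real (min (max i a) b) - real (min (max j a) b))\<^sup>2) / (1 + (real b - real a))"

lemma braess_iff:
  assumes ab: "1 \<le> a" "a + 2 \<le> b" "b \<le> k"
  shows "{a, b} \<in> braess_edges V E \<longleftrightarrow>
    2 * (\<Sum>i\<in>V. d i * X i) <
      2 * (real k + real p - 1) * (2 * X a + 2 * X b + 2 * (real b - real a) - Q a b)"
proof -
  have in_V: "a \<in> V" "b \<in> V" using ab by (auto simp: broom_verts_def)
  have notin: "{a, b} \<notin> E" using ab by (auto simp: edge_iff)
  have Dab: "D a b = real b - real a" using ab by (simp add: D_path)
  have "{a, b} \<in> braess_edges V E \<longleftrightarrow> kemeny V E < kemeny V (insert {a, b} E)"
  proof
    assume "{a, b} \<in> braess_edges V E"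
    then show "kemeny V E < kemeny V (insert {a, b} E)"
      unfolding braess_edges_def by auto
  next
    assume "kemeny V E < kemeny V (insert {a, b} E)"
    moreover have "a \<noteq> b" using ab by simp
    ultimately show "{a, b} \<in> braess_edges V E"
      unfolding braess_edges_def using in_V notin by blast
  qed
  also have "\<dots> \<longleftrightarrow> 2 * (\<Sum>i\<in>V. \<Sum>j\<in>V. deg i * deg j * D i j) <
      (\<Sum>i\<in>V. deg i) *
      (2 * (\<Sum>j\<in>V. deg j * D a j) + 2 * (\<Sum>j\<in>V. deg j * D b j) + 2 * D a b
        - (\<Sum>i\<in>V. \<Sum>j\<in>V. (deg i + of_bool (i = a) + of_bool (i = b)) *
            (deg j + of_bool (j = a) + of_bool (j = b)) *
            ((D a i - D b i + D a b) / 2 - (D a j - D b j + D a b) / 2)\<^sup>2) / (1 + D a b))"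
    using ab in_V notin Dab by (intro kemeny_less_insert_iff resistance_on_D) auto
  also have "(\<Sum>i\<in>V. deg i) = 2 * (real k + real p - 1)"
    by (simp add: deg_eq sum_d_eq)
  also have "(\<Sum>i\<in>V. \<Sum>j\<in>V. (deg i + of_bool (i = a) + of_bool (i = b)) *
            (deg j + of_bool (j = a) + of_bool (j = b)) *
            ((D a i - D b i + D a b) / 2 - (D a j - D b j + D a b) / 2)\<^sup>2) / (1 + D a b) = Q a b"
    unfolding Q_def Dab[symmetric] using ab
    by (subst (1 2) path_edge_potential) (auto simp: deg_eq)
  also have "(\<Sum>i\<in>V. \<Sum>j\<in>V. deg i * deg j * D i j) = (\<Sum>i\<in>V. d i * X i)"
    by (simp add: deg_eq X_def sum_distrib_left mult.assoc)
  also have "(\<Sum>j\<in>V. deg j * D a j) = X a"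
    by (simp add: deg_eq X_def)
  also have "(\<Sum>j\<in>V. deg j * D b j) = X b"
    by (simp add: deg_eq X_def)
  finally show ?thesis unfolding Dab .
qed

text \<open>Only the pairs with \<open>i \<le> a\<close> and \<open>j \<ge> b\<close> are kept.
  There are \<open>a * (k + p + 1 - b)\<close> of them, each with weight at least 1 and the full
  potential difference \<open>l\<close>. Finally \<open>l\<^sup>2 / (1 + l)\<close> is at least
  \<open>2 / 3 * l\<close> because \<open>l \<ge> 2\<close>.\<close>

lemma Q_ge:
  assumes ab: "1 \<le> a" "a + 2 \<le> b" "b \<le> k"
  shows "Q a b \<ge> 2 / 3 * (real a * (real (k + p) + 1 - real b) * (real b - real a))"
proof -
  define l where "l = real b - real a"
  have l: "l \<ge> 2" using ab by (simp add: l_def)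
  have "(\<Sum>i=1..a. \<Sum>j=b..k+p. l\<^sup>2) \<le> (\<Sum>i=1..a. \<Sum>j=b..k+p. (d i + of_bool (i = a) + of_bool (i = b)) *
      (d j + of_bool (j = a) + of_bool (j = b)) *
      (real (min (max i a) b) - real (min (max j a) b))\<^sup>2)"
  proof (intro sum_mono)
    fix i j assume ij: "i \<in> {1..a}" "j \<in> {b..k+p}"
    have "(real (min (max i a) b) - real (min (max j a) b))\<^sup>2 = l\<^sup>2"
    proof -
      have "min (max i a) b = a" "min (max j a) b = b" using ij ab by auto
      then show ?thesis by (simp add: l_def power2_commute)
    qed
    moreover have "1 * 1 \<le> (d i + of_bool (i = a) + of_bool (i = b)) * (d j + of_bool (j = a) + of_bool (j = b))"
      using d_ge_1[of i] d_ge_1[of j] by (intro mult_mono) auto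
    ultimately show "l\<^sup>2 \<le> (d i + of_bool (i = a) + of_bool (i = b)) *
      (d j + of_bool (j = a) + of_bool (j = b)) *
      (real (min (max i a) b) - real (min (max j a) b))\<^sup>2"
      using mult_right_mono[of 1 _ "l\<^sup>2"] by simp
  qed
  also have "\<dots> \<le> (\<Sum>i\<in>V. \<Sum>j\<in>V. (d i + of_bool (i = a) + of_bool (i = b)) *
      (d j + of_bool (j = a) + of_bool (j = b)) *
      (real (min (max i a) b) - real (min (max j a) b))\<^sup>2)"
  proof (intro double_sum_restrict_le finite_verts)
    fix i j
    show "(d i + of_bool (i = a) + of_bool (i = b)) * (d j + of_bool (j = a) + of_bool (j = b)) *
      (real (min (max i a) b) - real (min (max j a) b))\<^sup>2 \<ge> 0"
      using d_ge_1[of i] d_ge_1[of j] by (intro mult_nonneg_nonneg) auto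
  qed (use ab in \<open>auto simp: broom_verts_def\<close>)
  also have "\<dots> = Q a b * (1 + l)"
    using l by (simp add: Q_def l_def)
  finally have "(\<Sum>i=1..a. \<Sum>j=b..k+p. l\<^sup>2) \<le> Q a b * (1 + l)" .
  moreover define y where "y = real a * (real (k + p) + 1 - real b)"
  moreover have "(\<Sum>i=1..a. \<Sum>j=b..k+p. l\<^sup>2) = y * l\<^sup>2"
    using ab by (simp add: y_def of_nat_diff algebra_simps)
  ultimately have "y * l\<^sup>2 \<le> Q a b * (1 + l)"
    by argo
  moreover have "y * (2 / 3 * (l * (1 + l))) \<le> y * l\<^sup>2"
  proof (rule mult_left_mono)
    have "0 \<le> l * (l - 2)" using l by simp
    then show "2 / 3 * (l * (1 + l)) \<le> l\<^sup>2" by (simp add: power2_eq_square algebra_simps)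
  qed (use ab in \<open>auto simp: y_def\<close>)
  ultimately have "2 / 3 * (y * l) * (1 + l) \<le> Q a b * (1 + l)"
    by (simp add: mult_ac)
  then have "2 / 3 * (y * l) \<le> Q a b"
    using l by (subst (asm) mult_le_cancel_right_pos) auto
  then show ?thesis by (simp only: y_def l_def)
qed

text \<open>A pair with both indices at or beyond \<open>b\<close> contributes nothing, and no
  potential difference exceeds \<open>l\<close>. So one index lies below \<open>b\<close>, where the
  total weight is at most \<open>3 * b\<close>, while the other ranges over the total weight
  \<open>2 * (k + p)\<close>; the two choices of the first index give
  \<open>12 = 2 * 3 * 2\<close>.\<close>

lemma Q_le:
  assumes ab: "1 \<le> a" "a + 2 \<le> b" "b \<le> k"
  shows "Q a b \<le> 12 * (real b - real a) * real b * real (k + p)"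
proof -
  define l where "l = real b - real a"
  have l: "l \<ge> 2" using ab by (simp add: l_def)
  define d' where "d' i = d i + of_bool (i = a) + of_bool (i = b)" for i
  have d'_nonneg: "d' i \<ge> 0" for i using d_ge_1[of i] by (simp add: d'_def)
  have sum_d': "(\<Sum>i\<in>V. d' i) = 2 * real (k + p)"
  proof -
    have "a \<in> V" "b \<in> V" using ab by (auto simp: broom_verts_def)
    then show ?thesis
      using finite_verts by (simp add: d'_def sum.distrib sum_d_eq of_bool_def)
  qed
  have "(\<Sum>i\<in>V. d' i * of_bool (i < b)) = (\<Sum>i\<in>{1..<b}. d' i)"
    using ab by (intro sum.mono_neutral_cong_right) (auto simp: broom_verts_def)
  \<comment> \<open>Below \<open>b \<le> k\<close> the degree is at most 2, and the new edge adds 1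
    at \<open>a\<close>.\<close>
  also have "\<dots> \<le> (\<Sum>i\<in>{1..<b}. 3)"
    using ab by (intro sum_mono) (auto simp: d'_def d_def)
  also have "\<dots> \<le> 3 * real b" by (simp add: of_nat_diff)
  finally have mass: "(\<Sum>i\<in>V. d' i * of_bool (i < b)) \<le> 3 * real b" .
  have "Q a b * (1 + l) = (\<Sum>i\<in>V. \<Sum>j\<in>V. d' i * d' j *
      (real (min (max i a) b) - real (min (max j a) b))\<^sup>2)"
    using l by (simp add: Q_def l_def d'_def)
  also have "\<dots> \<le> (\<Sum>i\<in>V. \<Sum>j\<in>V. d' i * d' j * (l\<^sup>2 * (of_bool (i < b) + of_bool (j < b))))"
  proof (intro sum_mono mult_left_mono)
    fix i j
    have "\<bar>real (min (max i a) b) - real (min (max j a) b)\<bar> \<le> l"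
      using ab by (auto simp: l_def min_def max_def)
    then have "(real (min (max i a) b) - real (min (max j a) b))\<^sup>2 \<le> l\<^sup>2"
      using l by (metis abs_le_square_iff abs_of_nonneg order_trans zero_le_numeral)
    moreover have "(real (min (max i a) b) - real (min (max j a) b))\<^sup>2 = 0" if "b \<le> i" "b \<le> j"
      using that ab by (simp add: min_def max_def)
    ultimately show "(real (min (max i a) b) - real (min (max j a) b))\<^sup>2
        \<le> l\<^sup>2 * (of_bool (i < b) + of_bool (j < b))"
      by (cases "i < b"; cases "j < b") (auto intro: order_trans)
  qed (simp add: d'_nonneg)
  also have "\<dots> = (\<Sum>i\<in>V. \<Sum>j\<in>V. l\<^sup>2 * (d' i * of_bool (i < b)) * d' j)
      + (\<Sum>i\<in>V. \<Sum>j\<in>V. l\<^sup>2 * d' i * (d' j * of_bool (j < b)))"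
    unfolding sum.distrib[symmetric] by (intro sum.cong refl) (simp add: algebra_simps)
  also have "\<dots> = 2 * l\<^sup>2 * (\<Sum>i\<in>V. d' i * of_bool (i < b)) * (2 * real (k + p))"
    unfolding sum_distrib_left[symmetric] sum_distrib_right[symmetric] sum_d' by simp
  also have "\<dots> \<le> 2 * l\<^sup>2 * (3 * real b) * (2 * real (k + p))"
    using mass by (intro mult_right_mono mult_left_mono) auto
  also have "\<dots> = 12 * l\<^sup>2 * (real b * real (k + p))" by simp
  also have "\<dots> \<le> 12 * (l * (1 + l)) * (real b * real (k + p))"
    using l by (intro mult_right_mono mult_left_mono) (auto simp: power2_eq_square)
  also have "\<dots> = 12 * l * real b * real (k + p) * (1 + l)" by simp
  finally have "Q a b \<le> 12 * l * real b * real (k + p)"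
    using l by simp
  then show ?thesis by (simp add: l_def)
qed

section \<open>Necessary and sufficient conditions for Braess edges\<close>

text \<open>The left side of \<open>braess_iff\<close> is nonnegative, so \<open>Q a b\<close> is
  less than the gain. With \<open>z = k * (k + p)\<close> the gain is at most
  \<open>4 * z + 4 * z + 2 * z\<close>, and \<open>Q_ge\<close> turns \<open>10 * z\<close> into
  \<open>15 * z\<close>.\<close>

lemma braess_necessary:
  assumes ab: "1 \<le> a" "a + 2 \<le> b" "b \<le> k" and "{a, b} \<in> braess_edges V E"
  shows "real a * (real (k + p) + 1 - real b) * (real b - real a) \<le> 15 * real k * real (k + p)"
proof -
  have "D i j \<ge> 0" for i j by (simp add: D_def)
  then have "X i \<ge> 0" for i
    unfolding X_def using d_ge_1 by (intro sum_nonneg mult_nonneg_nonneg) (auto intro: order_trans[OF zero_le_one])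
  then have "0 \<le> 2 * (\<Sum>i\<in>V. d i * X i)"
    using d_ge_1 by (intro mult_nonneg_nonneg sum_nonneg) (auto intro: order_trans[OF zero_le_one])
  also have "\<dots> < 2 * (real k + real p - 1) * (2 * X a + 2 * X b + 2 * (real b - real a) - Q a b)"
    using braess_iff[OF ab] assms(4) by blast
  finally have "0 < 2 * X a + 2 * X b + 2 * (real b - real a) - Q a b"
    using k_ge by (simp add: zero_less_mult_iff)
  moreover have "X a \<le> 2 * real k * real (k + p)" "X b \<le> 2 * real k * real (k + p)"
    using ab by (intro X_path_le; simp)+
  moreover have "real b - real a \<le> real k * real (k + p)"
  proof -
    have "real b \<le> real k * 1" using ab by simp
    also have "\<dots> \<le> real k * real (k + p)" using k_ge by (intro mult_left_mono) auto
    finally show ?thesis by simp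
  qed
  moreover define y where "y = real a * (real (k + p) + 1 - real b) * (real b - real a)"
  moreover have "2 / 3 * y \<le> Q a b"
    using Q_ge[OF ab] by (simp only: y_def)
  moreover define z where "z = real k * real (k + p)"
  ultimately have "y \<le> 15 * z" by (simp add: mult.assoc z_def[symmetric])
  then show ?thesis by (simp add: y_def z_def mult.assoc)
qed

text \<open>Both endpoints are close to the free end, so \<open>2 * X a + 2 * X (a + l)\<close> is
  nearly \<open>4 * X 1\<close>, whereas the average of \<open>X\<close> on the left of
  \<open>braess_iff\<close> costs only \<open>2 * (X 1 + 2)\<close>. The surplus of about
  \<open>2 * X 1\<close> exceeds the loss \<open>Q\<close>.\<close>

lemma braess_sufficient:
  assumes a: "1 \<le> a" and l: "2 \<le> l" and al: "64 * (a * l) \<le> k" and ll: "64 * (l * l) \<le> k"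
  shows "a + l \<le> k" "{a, a + l} \<in> braess_edges V E"
proof -
  have "64 * (a * 2) \<le> 64 * (a * l)" using l by (intro mult_le_mono) auto
  then have a_le: "128 * a \<le> k" using al by linarith
  have "64 * (2 * l) \<le> 64 * (l * l)" using l by (intro mult_le_mono) auto
  then have l_le: "128 * l \<le> k" using ll by linarith
  show le: "a + l \<le> k" using a_le l_le by linarith
  have ab: "1 \<le> a" "a + 2 \<le> a + l" "a + l \<le> k" using a l le by auto
  define n where "n = real (k + p)"
  have n: "n > 0" using k_ge by (simp add: n_def)
  have kn: "real k * n > 0" using k_ge n by simp
  have "Q a (a + l) \<le> 12 * (real (a * l) + real (l * l)) * n"
    using Q_le[OF ab] by (simp add: n_def algebra_simps)
  also have "\<dots> \<le> 12 * (real k / 32) * n"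
  proof (intro mult_right_mono mult_left_mono)
    have "64 * real (a * l) \<le> real k" "64 * real (l * l) \<le> real k"
      using al ll by (metis of_nat_le_iff of_nat_mult of_nat_numeral)+
    then show "real (a * l) + real (l * l) \<le> real k / 32" by linarith
  qed (use n in auto)
  finally have Q: "Q a (a + l) \<le> 3 / 8 * (real k * n)" by simp
  have Xa: "X 1 \<le> X a + real k * n / 64"
  proof -
    have "2 * real a * n \<le> real k / 64 * n" using a_le n by (intro mult_right_mono) auto
    moreover have "X 1 \<le> X a + 2 * real a * n" unfolding n_def using ab by (intro X_1_le) auto
    ultimately show ?thesis by linarith
  qed
  have Xb: "X 1 \<le> X (a + l) + real k * n / 32"
  proof -
    have "2 * real (a + l) * n \<le> real k / 32 * n" using a_le l_le n by (intro mult_right_mono) auto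
    moreover have "X 1 \<le> X (a + l) + 2 * real (a + l) * n"
      unfolding n_def using ab by (intro X_1_le) auto
    ultimately show ?thesis by linarith
  qed
  \<comment> \<open>In units of \<open>k * n\<close>, the errors in \<open>Xa\<close> and
    \<open>Xb\<close> cost \<open>3 / 32\<close> and \<open>Q\<close> costs \<open>3 / 8\<close>,
    together \<open>15 / 32\<close>, against \<open>2 * X 1 \<ge> 2 / 3\<close>.\<close>
  have "2 * X 1 < 2 * X a + 2 * X (a + l) - Q a (a + l)"
    using Q Xa Xb X_1_ge[folded n_def] kn by linarith
  \<comment> \<open>Twice this length is at least 4, which pays for the additive 2 of
    \<open>X_le\<close>.\<close>
  moreover have "real (a + l) - real a \<ge> 2" using l by simp
  ultimately have less: "2 * (X 1 + 2) < 2 * X a + 2 * X (a + l) + 2 * (real (a + l) - real a) - Q a (a + l)"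
    by argo
  have "(\<Sum>i\<in>V. d i * X i) \<le> (\<Sum>i\<in>V. d i * (X 1 + 2))"
    using d_ge_1 X_le by (intro sum_mono mult_left_mono) (auto intro: order_trans[OF zero_le_one])
  also have "\<dots> = 2 * (real k + real p - 1) * (X 1 + 2)"
    unfolding sum_distrib_right[symmetric] sum_d_eq ..
  finally have "2 * (\<Sum>i\<in>V. d i * X i) \<le> 2 * (2 * (real k + real p - 1) * (X 1 + 2))"
    by (rule mult_left_mono) simp
  also have "\<dots> = 2 * (real k + real p - 1) * (2 * (X 1 + 2))"
    by (simp only: mult_ac)
  also have "\<dots> < 2 * (real k + real p - 1) *
      (2 * X a + 2 * X (a + l) + 2 * (real (a + l) - real a) - Q a (a + l))"
    using less k_ge by (intro mult_strict_left_mono) auto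
  finally show "{a, a + l} \<in> braess_edges V E"
    using braess_iff[OF ab] by blast
qed

end

section \<open>Counting\<close>

lemma nat_div_bounds:
  "real (m div y) \<le> real m / real y" "real m / real y < real (m div y) + 1"
  using floor_correct[of "real m / real y"] unfolding floor_divide_of_nat_eq by auto

lemma harm_le_ln: "n > 0 \<Longrightarrow> harm n \<le> ln (real n) + (1 :: real)"
proof (induction n)
  case (Suc n)
  have "decseq (\<lambda>n. harm (Suc n) - ln (real (Suc n)))"
    by (rule decseq_harm_diff_ln)
  from decseqD[OF this, of 0 n] show ?case by (simp add: harm_Suc harm_def[of 0])
qed simp

definition hyperbola_points :: "nat \<Rightarrow> (nat \<times> nat) set" where
  "hyperbola_points m = {(x, y). 1 \<le> x \<and> 1 \<le> y \<and> x * y \<le> m}"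

lemma hyperbola_points_Sigma: "hyperbola_points m = (SIGMA x:{1..m}. {1..m div x})"
proof -
  have "x \<le> m" if "x * y \<le> m" "1 \<le> y" for x y
    using mult_le_mono2[OF that(2), of x] that(1) by linarith
  then show ?thesis
    by (auto simp: hyperbola_points_def less_eq_div_iff_mult_less_eq mult.commute)
qed

lemma finite_hyperbola_points [simp]: "finite (hyperbola_points m)"
  by (simp add: hyperbola_points_Sigma)

lemma card_hyperbola_points_le:
  assumes "m > 0"
  shows "real (card (hyperbola_points m)) \<le> real m * (ln (real m) + 1)"
proof -
  have "real (card (hyperbola_points m)) = (\<Sum>x=1..m. real (m div x))"
    by (simp add: hyperbola_points_Sigma)
  also have "\<dots> \<le> (\<Sum>x=1..m. real m * inverse (real x))"
    using nat_div_bounds(1)[of m] by (intro sum_mono) (simp add: divide_inverse)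
  also have "\<dots> = real m * harm m"
    by (simp add: harm_def sum_distrib_left)
  also have "\<dots> \<le> real m * (ln (real m) + 1)"
    using harm_le_ln[OF assms] by (intro mult_left_mono) auto
  finally show ?thesis .
qed

text \<open>Only the rows \<open>2 \<le> y \<le> s\<close> are counted. There
  \<open>m div y \<ge> 1\<close>, so rounding down loses at most a factor 2, and the harmonic sum
  without its first term gives \<open>ln (s + 1) - 1\<close>.\<close>

lemma card_short_hyperbola_points_ge:
  assumes "s * s \<le> m"
  shows "real m / 2 * (ln (real s + 1) - 1) \<le>
    real (card {(x, y). 1 \<le> x \<and> 2 \<le> y \<and> x * y \<le> m \<and> y * y \<le> m})"
proof (cases "s = 0")
  case True
  then have "real m / 2 * (ln (real s + 1) - 1) \<le> 0" by simp
  then show ?thesis by (rule order_trans) simp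
next
  case False
  define A where "A = {(x, y). 1 \<le> x \<and> 2 \<le> y \<and> x * y \<le> m \<and> y * y \<le> m}"
  have y_le: "y \<le> m" if "y * y \<le> m" for y :: nat
    using that le_square order_trans by blast
  have x_le: "x \<le> m" if "x * y \<le> m" "2 \<le> y" for x y :: nat
    using that(1) mult_le_mono2[of 1 y x] that(2) by linarith
  have "A \<subseteq> {..m} \<times> {..m}"
    unfolding A_def using y_le x_le by blast
  then have "finite A" by (rule finite_subset) simp
  have "prod.swap ` (SIGMA y:{2..s}. {1..m div y}) \<subseteq> A"
  proof clarsimp
    fix x y assume xy: "2 \<le> y" "y \<le> s" "Suc 0 \<le> x" "x \<le> m div y"
    have "y * y \<le> s * s" using xy by (intro mult_le_mono) auto
    then show "(x, y) \<in> A"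
      using xy assms by (simp add: A_def less_eq_div_iff_mult_less_eq)
  qed
  from card_mono[OF \<open>finite A\<close> this]
  have card: "(\<Sum>y=2..s. m div y) \<le> card A"
    by (subst (asm) card_image) auto
  have "real m / 2 * (ln (real s + 1) - 1) \<le> real m / 2 * (harm s - 1)"
    using ln_le_harm[of s] by (intro mult_left_mono) auto
  also have "harm s - 1 = (\<Sum>y=2..s. inverse (real y))"
    using False by (simp add: harm_def sum.atLeast_Suc_atMost numeral_2_eq_2)
  also have "real m / 2 * (\<Sum>y=2..s. inverse (real y)) \<le> (\<Sum>y=2..s. real (m div y))"
    unfolding sum_distrib_left
  proof (intro sum_mono)
    fix y assume y: "y \<in> {2..s}"
    have "y * 1 \<le> s * s" using y by (intro mult_le_mono) auto
    then have "1 \<le> m div y" using y assms by (simp add: less_eq_div_iff_mult_less_eq)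
    then have "1 \<le> real (m div y)" by linarith
    moreover have "real m / real y < real (m div y) + 1"
      by (rule nat_div_bounds)
    moreover have "real m / 2 * inverse (real y) = real m / real y / 2"
      unfolding divide_inverse by (simp only: mult_ac)
    ultimately show "real m / 2 * inverse (real y) \<le> real (m div y)"
      by argo
  qed
  also have "\<dots> \<le> real (card A)"
    using card by (simp flip: of_nat_sum)
  finally show ?thesis by (simp add: A_def)
qed

section \<open>Counting the Braess edges of the path\<close>

context broom
begin

lemma finite_path_braess: "finite {e \<in> braess_edges V E. e \<subseteq> {1..k}}"
  by (rule finite_subset[of _ "Pow {1..k}"]) auto

lemma B3_ge:
  assumes "s * s \<le> k div 64"
  shows "real (k div 64) / 2 * (ln (real s + 1) - 1) \<le> real (B3 k p)"
proof -
  define m where "m = k div 64"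
  define A where "A = {(x, y). 1 \<le> x \<and> 2 \<le> y \<and> x * y \<le> m \<and> y * y \<le> m}"
  have "inj_on (\<lambda>(a, l). {a, a + l}) A"
    by (auto simp: inj_on_def A_def doubleton_eq_iff)
  moreover have "(\<lambda>(a, l). {a, a + l}) ` A \<subseteq> {e \<in> braess_edges V E. e \<subseteq> {1..k}}"
  proof clarify
    fix a l assume "(a, l) \<in> A"
    then have *: "1 \<le> a" "2 \<le> l" "64 * (a * l) \<le> k" "64 * (l * l) \<le> k"
      by (auto simp: A_def m_def)
    with braess_sufficient[OF *] show "{a, a + l} \<in> braess_edges V E \<and> {a, a + l} \<subseteq> {1..k}"
      by auto
  qed
  ultimately have "card A \<le> B3 k p"
    unfolding B3_def by (intro card_inj_on_le finite_path_braess)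
  then show ?thesis
    using card_short_hyperbola_points_ge[OF assms] by (simp add: A_def m_def)
qed

text \<open>Since \<open>a + l + c\<close> is fixed, any two of \<open>a\<close>, \<open>l\<close>,
  \<open>c\<close> determine the edge. The largest of the three is at least
  \<open>(k + p) / 3\<close>; dividing it out of \<open>a * c * l \<le> 15 * k * (k + p)\<close>
  leaves a product of at most \<open>45 * k\<close>. The three images may overlap, which is harmless
  for an upper bound.\<close>

lemma path_braess_cases:
  assumes "e \<in> braess_edges V E" "e \<subseteq> {1..k}"
  shows "e \<in> (\<lambda>(a, l). {a, a + l}) ` hyperbola_points (45 * k)
     \<union> (\<lambda>(a, c). {a, k + p + 1 - c}) ` hyperbola_points (45 * k)
     \<union> (\<lambda>(l, c). {k + p + 1 - c - l, k + p + 1 - c}) ` hyperbola_points (45 * k)"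
proof -
  from assms(1) obtain u v where uv: "e = {u, v}" "u \<noteq> v" "{u, v} \<notin> E"
    by (auto simp: braess_edges_def)
  define a b where "a = min u v" and "b = max u v"
  have e: "e = {a, b}" using uv by (auto simp: a_def b_def min_def max_def)
  have "a < b" using uv by (auto simp: a_def b_def)
  moreover have bounds: "1 \<le> a" "b \<le> k" using assms(2) e by auto
  moreover have "b \<noteq> a + 1"
  proof
    assume "b = a + 1"
    then have "{a, b} \<in> E" using bounds by (auto simp: edge_iff)
    with uv e show False by simp
  qed
  ultimately have ab: "1 \<le> a" "a + 2 \<le> b" "b \<le> k" by auto
  define l c where "l = b - a" and "c = k + p + 1 - b"
  have lc: "1 \<le> l" "1 \<le> c" "b = a + l" "b = k + p + 1 - c" "a = k + p + 1 - c - l" "a + l + c = k + p + 1"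
    using ab by (auto simp: l_def c_def)
  have "real a * real c * real l \<le> 15 * real k * real (k + p)"
    using braess_necessary[OF ab] assms(1) ab unfolding e l_def c_def
    by (simp add: of_nat_diff add_ac)
  then have prod: "a * c * l \<le> 15 * k * (k + p)"
    by (metis of_nat_le_iff of_nat_mult of_nat_numeral)
  have third: "x * y \<le> 45 * k" if "k + p \<le> 3 * z" "x * y * z \<le> 15 * k * (k + p)" for x y z
  proof -
    have "x * y * z \<le> 15 * k * (3 * z)"
      using that by (meson le_trans mult_le_mono2)
    then have "x * y * z \<le> 45 * k * z" by simp
    moreover have "z > 0" using that k_ge by (cases z) auto
    ultimately show ?thesis by simp
  qed
  consider "k + p \<le> 3 * c" | "k + p \<le> 3 * l" | "k + p \<le> 3 * a"
    using lc(6) by linarith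
  then show ?thesis
  proof cases
    case 1
    then have "(a, l) \<in> hyperbola_points (45 * k)"
      using third[of c a l] prod ab(1) lc(1,2) by (simp add: hyperbola_points_def mult_ac)
    then have "{a, b} \<in> (\<lambda>(a, l). {a, a + l}) ` hyperbola_points (45 * k)"
      by (rule rev_image_eqI) (use lc(3) in simp)
    then show ?thesis using e by blast
  next
    case 2
    then have "(a, c) \<in> hyperbola_points (45 * k)"
      using third[of l a c] prod ab(1) lc(1,2) by (simp add: hyperbola_points_def mult_ac)
    then have "{a, b} \<in> (\<lambda>(a, c). {a, k + p + 1 - c}) ` hyperbola_points (45 * k)"
      by (rule rev_image_eqI) (use lc(4) in simp)
    then show ?thesis using e by blast
  next
    case 3
    then have "(l, c) \<in> hyperbola_points (45 * k)"
      using third[of a l c] prod ab(1) lc(1,2) by (simp add: hyperbola_points_def mult_ac)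
    then have "{a, b} \<in> (\<lambda>(l, c). {k + p + 1 - c - l, k + p + 1 - c}) ` hyperbola_points (45 * k)"
      by (rule rev_image_eqI) (use lc(4,5) in simp)
    then show ?thesis using e by blast
  qed
qed

lemma B3_le: "real (B3 k p) \<le> 135 * real k * (ln (45 * real k) + 1)"
proof -
  let ?H = "hyperbola_points (45 * k)"
  have "B3 k p \<le> card ((\<lambda>(a, l). {a, a + l}) ` ?H \<union> (\<lambda>(a, c). {a, k + p + 1 - c}) ` ?H
     \<union> (\<lambda>(l, c). {k + p + 1 - c - l, k + p + 1 - c}) ` ?H)"
    unfolding B3_def using path_braess_cases by (intro card_mono) auto
  also have "\<dots> \<le> card ?H + card ?H + card ?H"
    by (intro order_trans[OF card_Un_le] add_mono card_image_le) auto
  finally have "real (B3 k p) \<le> 3 * real (card ?H)" by simp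
  also have "\<dots> \<le> 3 * (real (45 * k) * (ln (real (45 * k)) + 1))"
    using k_ge by (intro mult_left_mono card_hyperbola_points_le) auto
  finally show ?thesis by simp
qed

end

theorem theorem5p19:
  fixes p :: "nat \<Rightarrow> nat" and \<beta> :: ennreal
  assumes "\<And>k. k \<ge> 3 \<Longrightarrow> p k \<ge> 2"
    and "(\<lambda>k. ennreal (real (p k) / real k)) \<longlonglongrightarrow> \<beta>"
  shows "(\<lambda>k. real (B3 k (p k))) \<in> \<Theta>(\<lambda>k. real k * ln (real k))"
proof -
  have broom: "broom k (p k)" if "k \<ge> 3" for k
    using that assms(1)[OF that] by unfold_locales auto
  have "(\<lambda>k. real (B3 k (p k))) \<in> O(\<lambda>k. 135 * real k * (ln (45 * real k) + 1))"
  proof (intro landau_o.big_mono eventually_mono[OF eventually_ge_at_top[of 3]])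
    fix k :: nat assume "k \<ge> 3"
    from broom.B3_le[OF broom[OF this]]
    show "norm (real (B3 k (p k))) \<le> norm (135 * real k * (ln (45 * real k) + 1))"
      by simp
  qed
  also have "(\<lambda>k. 135 * real k * (ln (45 * real k) + 1)) \<in> O(\<lambda>k. real k * ln (real k))"
    by real_asymp
  finally have upper: "(\<lambda>k. real (B3 k (p k))) \<in> O(\<lambda>k. real k * ln (real k))" .
  \<comment> \<open>The first floor is \<open>k div 64\<close> in a form suited to
    \<open>real_asymp\<close>. Subtracting 1 under the root ensures
    \<open>s * s \<le> k div 64\<close> for the rounded root \<open>s\<close>, as
    \<open>B3_ge\<close> requires.\<close>
  have "(\<lambda>k. real k * ln (real k)) \<in>
      O(\<lambda>k. real (nat \<lfloor>real k / 64\<rfloor>) / 2 * (ln (real (nat \<lfloor>sqrt (real k / 64 - 1)\<rfloor>) + 1) - 1))"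
    by real_asymp
  also have "(\<lambda>k. real (nat \<lfloor>real k / 64\<rfloor>) / 2 * (ln (real (nat \<lfloor>sqrt (real k / 64 - 1)\<rfloor>) + 1) - 1)) \<in>
      O(\<lambda>k. real (B3 k (p k)))"
  proof (intro landau_o.big_mono)
    have "eventually (\<lambda>k::nat. ln (real (nat \<lfloor>sqrt (real k / 64 - 1)\<rfloor>) + 1) - 1 \<ge> 0) at_top"
      by real_asymp
    then show "eventually (\<lambda>k. norm (real (nat \<lfloor>real k / 64\<rfloor>) / 2 *
        (ln (real (nat \<lfloor>sqrt (real k / 64 - 1)\<rfloor>) + 1) - 1)) \<le> norm (real (B3 k (p k)))) at_top"
      \<comment> \<open>From \<open>k = 64\<close> on, the radicand is nonnegative.\<close>
      using eventually_ge_at_top[of 64]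
    proof eventually_elim
      case (elim k)
      define s where "s = nat \<lfloor>sqrt (real k / 64 - 1)\<rfloor>"
      have floor: "nat \<lfloor>real k / 64\<rfloor> = k div 64"
        using floor_divide_of_nat_eq[of k 64, where ?'a = real] by simp
      have "real s \<le> sqrt (real k / 64 - 1)"
        unfolding s_def using elim by (intro of_nat_floor) simp
      then have "real s * real s \<le> real k / 64 - 1"
        using elim by (metis abs_of_nat real_sqrt_abs2 real_sqrt_le_iff)
      then have "real (s * s) < real (k div 64) + 1"
        using nat_div_bounds(2)[of k 64] by simp
      then have "s * s \<le> k div 64" by linarith
      from broom.B3_ge[OF broom this] elim show ?case
        unfolding floor s_def by simp
    qed
  qed
  finally have "(\<lambda>k. real (B3 k (p k))) \<in> \<Omega>(\<lambda>k. real k * ln (real k))"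
    by (simp add: bigomega_iff_bigo)
  with upper show ?thesis by (simp add: bigtheta_def)
qed

end
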